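(* For any dimension $d\ge 2$ there exist constants $0<c<C<\infty$, depending only on $d$, such that for every $L$ large enough (i.e. for all $L\ge L_0$ for some $L_0$), $$cL^{-1}\le \lambda_{c,r}(L)\le CL^{-1}.$$
   Context: Poisson stick model in $\mathbb{R}^d$, $d\ge 2$. Let $\mathbb{S}=\{p\in\mathbb{R}^d:\Vert p\Vert=1\}$ (Euclidean norm). For $(x,p)\in\mathbb{R}^d\times\mathbb{S}$ and $L>0$ let $\ell_{x,p,L}=\{x+tp:-L/2\le t\le L/2\}$ and let the stick be $S_{x,p,L}=\{y\in\mathbb{R}^d:\mathrm{dist}(y,\ell_{x,p,L})\le 1\}$. For a probability measure $\Theta$ on $\mathbb{S}$ (the orientation distribution) and $\lambda>0$ let $\Pi^\lambda$ be a Poisson point process on $\mathbb{R}^d\times\mathbb{S}$ with intensity measure $\mu_\lambda=\lambda\,\mathrm{Leb}\otimes\Theta$, where $\mathrm{Leb}$ is Lebesgue measure on $\mathbb{R}^d$. Let $\mathcal{C}(\Pi^\lambda)=\bigcup_{(x,p)\in\Pi^\lambda}S_{x,p,L}$. One says $\mathcal{C}(\Pi^\lambda)$ percolates if it contains an unbounded connected component; this event has probability $0$ or $1$. Define $\lambda_{c,\Theta}(L)=\inf\{\lambda>0:\mathbb{P}(\mathcal{C}(\Pi^\lambda)\text{ percolates})=1\}$. Rigid case: $\lambda_{c,r}(L)$ denotes $\lambda_{c,\Theta}(L)$ when $\Theta=\delta_{e_2}$, the point mass at the second standard unit vector $e_2$ (all sticks have the same direction). *)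

theory Defs
  imports "HOL-Probability.Probability" "HOL-Library.Disjoint_Sets"
begin

section \<open>Poisson point processes\<close>

definition num_points :: "'a set \<Rightarrow> 'a set \<Rightarrow> ennreal" where
  "num_points A \<omega> = emeasure (count_space UNIV) (\<omega> \<inter> A)"

text \<open>
  \<open>P\<close> is the law of a (simple) Poisson point process with intensity measure \<open>\<mu>\<close>, i.e. the
  sample space consists of the configurations \<open>\<omega>\<close> (sets of points) themselves and the process is
  the identity map on it.  Configurations as sets, rather than multisets, are adequate for
  intensities without atoms; those below have a Lebesgue factor.  That sets of infinite intensity
  almost surely contain infinitely many points follows from these axioms when \<open>\<mu>\<close> is
  sigma-finite.
\<close>

definition poisson_process :: "'a set measure \<Rightarrow> 'a measure \<Rightarrow> bool" where
  "poisson_process P \<mu> \<longleftrightarrow>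
     prob_space P \<and>
     (\<forall>\<omega>\<in>space P. \<omega> \<subseteq> space \<mu>) \<and>
     (\<forall>A\<in>sets \<mu>. num_points A \<in> borel_measurable P) \<and>
     (\<forall>A\<in>sets \<mu>. emeasure \<mu> A < \<infinity> \<longrightarrow>
        (\<forall>k::nat. measure P {\<omega> \<in> space P. num_points A \<omega> = of_nat k}
                  = exp (- measure \<mu> A) * measure \<mu> A ^ k / fact k)) \<and>
     (\<forall>F. finite F \<and> F \<subseteq> sets \<mu> \<and> disjoint F \<longrightarrow>
        prob_space.indep_vars P (\<lambda>_. borel) num_points F)"

section \<open>The Poisson stick model\<close>

definition axis_segment :: "'a::euclidean_space \<Rightarrow> 'a \<Rightarrow> real \<Rightarrow> 'a set" where
  "axis_segment x p L = {x + t *\<^sub>R p |t. - L / 2 \<le> t \<and> t \<le> L / 2}"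

definition stick :: "'a::euclidean_space \<Rightarrow> 'a \<Rightarrow> real \<Rightarrow> 'a set" where
  "stick x p L = {y. infdist y (axis_segment x p L) \<le> 1}"

definition covered :: "real \<Rightarrow> ('a::euclidean_space \<times> 'a) set \<Rightarrow> 'a set" where
  "covered L \<omega> = (\<Union>(x, p)\<in>\<omega>. stick x p L)"

definition percolates :: "'a::euclidean_space set \<Rightarrow> bool" where
  "percolates U \<longleftrightarrow> (\<exists>K\<in>components U. \<not> bounded K)"

definition stick_intensity ::
    "real \<Rightarrow> 'a::euclidean_space measure \<Rightarrow> ('a \<times> 'a) measure" where
  "stick_intensity lam \<Theta> = scale_measure (ennreal lam) (lborel \<Otimes>\<^sub>M \<Theta>)"

text \<open>
  Probabilities of percolation are taken in the completed probability space, which changes nothing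
  for measurable events.  The infimum is formed in the extended reals, so that it is \<open>\<infinity>\<close>
  if no intensity percolates.
\<close>

definition critical_intensity ::
    "(real \<Rightarrow> ('a::euclidean_space \<times> 'a) set measure) \<Rightarrow> real \<Rightarrow> ereal" where
  "critical_intensity P L =
     Inf {ereal lam |lam. 0 < lam \<and>
       measure (completion (P lam)) {\<omega> \<in> space (P lam). percolates (covered L \<omega>)} = 1}"

text \<open>
  The index type is linearly ordered, so that its second smallest element, hence the second
  standard unit vector, makes sense (in dimension at least two).
\<close>

definition e2 :: "real ^ 'n::{finite,linorder}" where
  "e2 = axis (sorted_list_of_set UNIV ! 1) 1"

definition rigid_orientation :: "(real ^ 'n::{finite,linorder}) measure" where
  "rigid_orientation = return (restrict_space borel (sphere 0 1)) e2"

end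

theory Submission
  imports Defs
begin

text \<open>
  Both bounds compare the model with site percolation on a grid of boxes of length of order \<open>L\<close> in
  direction \<open>e2\<close> and of constant width in the other directions; the number of points in such a box
  is Poisson with mean of order \<open>lam * L\<close>.

  Lower bound: an unbounded component forces arbitrarily long self-avoiding walks of occupied boxes
  starting from some box.  There are at most \<open>D ^ n\<close> walks of length \<open>n\<close>, where \<open>D = 9 ^ d\<close>, and each is
  occupied with probability at most \<open>(lam * L) ^ n\<close>, so this has probability zero for small \<open>lam * L\<close>.

  Upper bound: in a two-dimensional slice, sticks in neighbouring occupied boxes meet.  Percolation of
  the occupied boxes follows by renormalisation instead of a contour argument: a \<open>3 \<times> 3\<close> block is good
  if at most one of its sub-blocks is bad.  Good sub-blocks of a good block are linked, and so are
  neighbouring good blocks, without any planar topology.  The probability that a block of level \<open>k\<close> is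
  bad is at most \<open>(81 * q) ^ 2 ^ k\<close>, where \<open>q\<close> is the vacancy probability of one box, so by Borel-Cantelli
  almost surely all but finitely many blocks at the corner of the quadrant are good.
\<close>

section \<open>Renormalised site percolation\<close>

text \<open>The block of level \<open>k\<close> with index \<open>(i, j)\<close> consists of the
  sites whose coordinates, divided by \<open>3 ^ k\<close>, have quotients \<open>i\<close> and
  \<open>j\<close>. The blocks with index \<open>(0, 0)\<close> thus increase with \<open>k\<close>
  and exhaust the quadrant.\<close>

fun good_block :: "(nat \<Rightarrow> nat \<Rightarrow> bool) \<Rightarrow> nat \<Rightarrow> nat \<Rightarrow> nat \<Rightarrow> bool" where
  "good_block occ 0 i j = occ i j"
| "good_block occ (Suc k) i j =
     (\<exists>a0<3. \<exists>b0<3. \<forall>a<3. \<forall>b<3. (a, b) \<noteq> (a0, b0) \<longrightarrow> good_block occ k (3 * i + a) (3 * j + b))"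

text \<open>
  Every bad block of level \<open>k\<close> contains a set of \<open>2 ^ k\<close> vacant sites, obtained by repeatedly choosing
  two bad sub-blocks.  A union bound over these sets replaces independence of the sub-blocks, so that
  only void probabilities enter.
\<close>

fun bad_witnesses :: "nat \<Rightarrow> nat \<times> nat \<Rightarrow> (nat \<times> nat) set set" where
  "bad_witnesses 0 v = {{v}}"
| "bad_witnesses (Suc k) v =
     {S \<union> T |S T a b a' b'. a < 3 \<and> b < 3 \<and> a' < 3 \<and> b' < 3 \<and> (a, b) \<noteq> (a', b') \<and>
        S \<in> bad_witnesses k (3 * fst v + a, 3 * snd v + b) \<and>
        T \<in> bad_witnesses k (3 * fst v + a', 3 * snd v + b')}"

lemma bad_block_witness:
  assumes "\<not> good_block occ k i j"
  shows "\<exists>S\<in>bad_witnesses k (i, j). \<forall>(a, b)\<in>S. \<not> occ a b"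
  using assms
proof (induction k arbitrary: i j)
  case 0
  then show ?case by simp
next
  case (Suc k)
  let ?g = "\<lambda>a b. good_block occ k (3 * i + a) (3 * j + b)"
  have bad: "\<exists>a<3. \<exists>b<3. (a, b) \<noteq> (a0, b0) \<and> \<not> ?g a b" if "a0 < 3" "b0 < 3" for a0 b0
    using Suc.prems that by auto
  \<comment> \<open>Any exceptional position yields a first bad sub-block; making that one the
    exception then yields a second, different one.\<close>
  obtain a b where ab: "a < 3" "b < 3" "\<not> ?g a b"
    using bad[of 0 0] by auto
  obtain a' b' where ab': "a' < 3" "b' < 3" "(a', b') \<noteq> (a, b)" "\<not> ?g a' b'"
    using bad[OF ab(1,2)] by blast
  obtain S where S: "S \<in> bad_witnesses k (3 * i + a, 3 * j + b)" "\<forall>(a, b)\<in>S. \<not> occ a b"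
    using Suc.IH[OF ab(3)] by blast
  obtain T where T: "T \<in> bad_witnesses k (3 * i + a', 3 * j + b')" "\<forall>(a, b)\<in>T. \<not> occ a b"
    using Suc.IH[OF ab'(4)] by blast
  have "S \<union> T \<in> bad_witnesses (Suc k) (i, j)"
    unfolding bad_witnesses.simps mem_Collect_eq fst_conv snd_conv
    using ab ab' S(1) T(1) by metis
  moreover have "\<forall>(a, b)\<in>S \<union> T. \<not> occ a b"
    using S(2) T(2) by blast
  ultimately show ?case by blast
qed

text \<open>A witness lies inside its block, so witnesses of different sub-blocks are disjoint. This
  is what makes the size in \<open>card_bad_witness\<close> exact.\<close>

lemma bad_witnesses_block:
  assumes "S \<in> bad_witnesses k v" "w \<in> S"
  shows "fst w div 3 ^ k = fst v" "snd w div 3 ^ k = snd v"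
proof -
  have "fst w div 3 ^ k = fst v \<and> snd w div 3 ^ k = snd v"
    using assms
  proof (induction k arbitrary: v S)
    case 0
    then show ?case by simp
  next
    case (Suc k)
    obtain a b T where ab: "a < 3" "b < 3" and
      T: "T \<in> bad_witnesses k (3 * fst v + a, 3 * snd v + b)" "w \<in> T"
      using Suc.prems unfolding bad_witnesses.simps mem_Collect_eq by (metis UnE)
    have "fst w div 3 ^ k div 3 = fst v" "snd w div 3 ^ k div 3 = snd v"
      using Suc.IH[OF T] ab by auto
    then show ?case
      by (simp add: div_mult2_eq[symmetric] mult.commute)
  qed
  then show "fst w div 3 ^ k = fst v" "snd w div 3 ^ k = snd v" by auto
qed

lemma card_bad_witness:
  assumes "S \<in> bad_witnesses k v"
  shows "finite S \<and> card S = 2 ^ k"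
  using assms
proof (induction k arbitrary: v S)
  case 0
  then show ?case by simp
next
  case (Suc k)
  obtain a b a' b' T U where neq: "(a, b) \<noteq> (a', b')" and
    T: "T \<in> bad_witnesses k (3 * fst v + a, 3 * snd v + b)" and
    U: "U \<in> bad_witnesses k (3 * fst v + a', 3 * snd v + b')" and S: "S = T \<union> U"
    using Suc.prems unfolding bad_witnesses.simps mem_Collect_eq by (elim exE conjE) (rule that)
  have "T \<inter> U = {}"
    using bad_witnesses_block[OF T] bad_witnesses_block[OF U] neq by fastforce
  then show ?case
    using Suc.IH[OF T] Suc.IH[OF U] S by (simp add: card_Un_disjoint)
qed

text \<open>A witness of level \<open>Suc k\<close> comes from an ordered pair of sub-blocks, at
  most \<open>9 * 9 = 81\<close> choices, and one witness for each. So the count at most squares and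
  gains a factor 81; the factor 81 on the left turns this recursion into pure squaring.\<close>

lemma card_bad_witnesses:
  "finite (bad_witnesses k v) \<and> 81 * card (bad_witnesses k v) \<le> 81 ^ 2 ^ k"
proof (induction k arbitrary: v)
  case 0
  then show ?case by simp
next
  case (Suc k)
  define I :: "(nat \<times> nat \<times> nat \<times> nat) set" where
    "I = {(a, b, a', b'). a < 3 \<and> b < 3 \<and> a' < 3 \<and> b' < 3 \<and> (a, b) \<noteq> (a', b')}"
  define F where "F = (\<lambda>(a, b, a', b').
    (\<lambda>(S, T). S \<union> T) ` (bad_witnesses k (3 * fst v + a, 3 * snd v + b) \<times>
                             bad_witnesses k (3 * fst v + a', 3 * snd v + b')))"
  define N :: nat where "N = 81 ^ 2 ^ k"
  have sub: "bad_witnesses (Suc k) v \<subseteq> (\<Union>x\<in>I. F x)"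
  proof
    fix S assume "S \<in> bad_witnesses (Suc k) v"
    then obtain a b a' b' T U where *: "(a, b, a', b') \<in> I" "S = T \<union> U"
      "(T, U) \<in> bad_witnesses k (3 * fst v + a, 3 * snd v + b) \<times>
                bad_witnesses k (3 * fst v + a', 3 * snd v + b')"
      unfolding bad_witnesses.simps I_def by blast
    then have "S \<in> F (a, b, a', b')"
      unfolding F_def by (auto intro!: image_eqI[OF _ *(3)])
    then show "S \<in> (\<Union>x\<in>I. F x)" using *(1) by blast
  qed
  have I_sub: "I \<subseteq> {..<3} \<times> {..<3} \<times> {..<3} \<times> {..<3}"
    unfolding I_def by auto
  have "finite I" using I_sub by (rule finite_subset) simp
  have "card I \<le> 81"
    using card_mono[OF _ I_sub] by simp
  have F: "finite (F x) \<and> 81 * (81 * card (F x)) \<le> N * N" for x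
  proof -
    obtain a b a' b' where x: "x = (a, b, a', b')" by (cases x)
    let ?S = "bad_witnesses k (3 * fst v + a, 3 * snd v + b)"
    let ?T = "bad_witnesses k (3 * fst v + a', 3 * snd v + b')"
    have fin: "finite (?S \<times> ?T)" using Suc.IH by simp
    have "card (F x) \<le> card ?S * card ?T"
      unfolding x F_def using card_image_le[OF fin] by (simp add: card_cartesian_product)
    then have "81 * (81 * card (F x)) \<le> (81 * card ?S) * (81 * card ?T)"
      by simp
    also have "\<dots> \<le> N * N"
      unfolding N_def using Suc.IH by (intro mult_mono) auto
    finally show ?thesis
      unfolding x F_def using fin by simp
  qed
  have "card (\<Union>x\<in>I. F x) \<le> (\<Sum>x\<in>I. card (F x))"
    by (rule card_UN_le) fact
  then have "81 * card (\<Union>x\<in>I. F x) * 81 \<le> (\<Sum>x\<in>I. 81 * (81 * card (F x)))"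
    by (simp add: sum_distrib_left[symmetric])
  also have "\<dots> \<le> card I * (N * N)"
    using sum_bounded_above[of I "\<lambda>x. 81 * (81 * card (F x))" "N * N"] F by simp
  also have "\<dots> \<le> 81 * (N * N)"
    using \<open>card I \<le> 81\<close> by simp
  finally have "81 * card (\<Union>x\<in>I. F x) \<le> N * N" by simp
  moreover have "N * N = 81 ^ 2 ^ Suc k"
    unfolding N_def by (simp add: power_add[symmetric] mult_2)
  moreover have "finite (\<Union>x\<in>I. F x)"
    using F \<open>finite I\<close> by auto
  ultimately show ?case
    using finite_subset[OF sub] card_mono[OF _ sub] by simp
qed

section \<open>Deterministic linking of good blocks\<close>

text \<open>\<open>R\<close> abstracts connection, within the covered set, of points attached to the
  sites. Reflexivity is demanded at occupied sites only, because the point attached to a vacant site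
  may be uncovered.\<close>

locale grid_links =
  fixes occ :: "nat \<Rightarrow> nat \<Rightarrow> bool" and R :: "nat \<times> nat \<Rightarrow> nat \<times> nat \<Rightarrow> bool"
  assumes link_refl: "occ i j \<Longrightarrow> R (i, j) (i, j)"
    and link_sym: "R u v \<Longrightarrow> R v u"
    and link_trans: "R u v \<Longrightarrow> R v w \<Longrightarrow> R u w"
    and link_right: "occ i j \<Longrightarrow> occ (Suc i) j \<Longrightarrow> R (i, j) (Suc i, j)"
    and link_up: "occ i j \<Longrightarrow> occ i (Suc j) \<Longrightarrow> R (i, j) (i, Suc j)"
begin

abbreviation good :: "nat \<Rightarrow> nat \<Rightarrow> nat \<Rightarrow> bool" where
  "good \<equiv> good_block occ"

text \<open>A site standing for a good block, reached by descending through good sub-blocks; the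
  conditions with \<open>div 3\<close> say that \<open>w\<close> is one of the nine sub-blocks of
  \<open>v\<close>. No meaning is attached to the value at a bad block.\<close>

fun rep :: "nat \<Rightarrow> nat \<times> nat \<Rightarrow> nat \<times> nat" where
  "rep 0 v = v"
| "rep (Suc k) v = rep k (SOME w. fst w div 3 = fst v \<and> snd w div 3 = snd v \<and> good k (fst w) (snd w))"

lemma good_Suc_witness:
  assumes "good (Suc k) i j"
  defines "w \<equiv> SOME w. fst w div 3 = i \<and> snd w div 3 = j \<and> good k (fst w) (snd w)"
  shows "fst w div 3 = i \<and> snd w div 3 = j \<and> good k (fst w) (snd w)"
proof -
  obtain a0 b0 where *: "a0 < 3" "b0 < 3"
    "\<forall>a<3. \<forall>b<3. (a, b) \<noteq> (a0, b0) \<longrightarrow> good k (3 * i + a) (3 * j + b)"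
    using assms by auto
  \<comment> \<open>Any \<open>a\<close> other than \<open>a0\<close> keeps the sub-block
    \<open>(a, 0)\<close> away from the exception.\<close>
  define a where "a = (if a0 = 0 then 1 else 0 :: nat)"
  have "good k (3 * i + a) (3 * j)"
    using *(3)[rule_format, of a 0] by (auto simp: a_def split: if_splits)
  moreover have "(3 * i + a) div 3 = i" by (auto simp: a_def)
  ultimately have "\<exists>w. fst w div 3 = i \<and> snd w div 3 = j \<and> good k (fst w) (snd w)"
    by (intro exI[of _ "(3 * i + a, 3 * j)"]) simp
  then show ?thesis
    unfolding w_def by (rule someI_ex)
qed

text \<open>The first coordinate is tracked because it later shows that representatives of distant
  blocks are themselves distant.\<close>

lemma rep_occ:
  assumes "good k i j"
  shows "case_prod occ (rep k (i, j))" "fst (rep k (i, j)) div 3 ^ k = i"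
proof -
  have "case_prod occ (rep k (i, j)) \<and> fst (rep k (i, j)) div 3 ^ k = i"
    using assms
  proof (induction k arbitrary: i j)
    case 0
    then show ?case by simp
  next
    case (Suc k)
    define w where "w = (SOME w. fst w div 3 = i \<and> snd w div 3 = j \<and> good k (fst w) (snd w))"
    have w: "fst w div 3 = i \<and> snd w div 3 = j \<and> good k (fst w) (snd w)"
      unfolding w_def by (rule good_Suc_witness) fact
    have "case_prod occ (rep k w) \<and> fst (rep k w) div 3 ^ k = fst w"
      using Suc.IH[of "fst w" "snd w"] w by simp
    moreover have "rep (Suc k) (i, j) = rep k w"
      by (simp add: w_def)
    moreover have "x div 3 ^ Suc k = x div 3 ^ k div 3" for x :: nat
      by (simp add: div_mult2_eq[symmetric] mult.commute)
    ultimately show ?case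
      using w by auto
  qed
  then show "case_prod occ (rep k (i, j))" "fst (rep k (i, j)) div 3 ^ k = i" by auto
qed

lemma rep_refl:
  assumes "good k i j"
  shows "R (rep k (i, j)) (rep k (i, j))"
  using link_refl rep_occ(1)[OF assms] by (auto split: prod.splits)

definition adjacent_linked :: "nat \<Rightarrow> bool" where
  "adjacent_linked k \<longleftrightarrow> (\<forall>i j.
     (good k i j \<longrightarrow> good k (Suc i) j \<longrightarrow> R (rep k (i, j)) (rep k (Suc i, j))) \<and>
     (good k i j \<longrightarrow> good k i (Suc j) \<longrightarrow> R (rep k (i, j)) (rep k (i, Suc j))))"

lemma adjacent_linkedD:
  assumes "adjacent_linked k" "good k i j"
  shows "good k (Suc i) j \<Longrightarrow> R (rep k (i, j)) (rep k (Suc i, j))"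
    and "good k i (Suc j) \<Longrightarrow> R (rep k (i, j)) (rep k (i, Suc j))"
  using assms unfolding adjacent_linked_def by blast+

lemma three_linked:
  fixes f :: "nat \<Rightarrow> nat \<times> nat"
  assumes "\<And>x. x < 3 \<Longrightarrow> R (f x) (f x)" "R (f 0) (f 1)" "R (f 1) (f 2)" "x < 3" "y < 3"
  shows "R (f x) (f y)"
proof -
  have xy: "x = 0 \<or> x = 1 \<or> x = 2" "y = 0 \<or> y = 1 \<or> y = 2"
    using assms by auto
  have "R (f 0) (f 2)" "R (f 1) (f 0)" "R (f 2) (f 1)" "R (f 2) (f 0)"
    using assms(2,3) by (blast intro: link_sym link_trans)+
  then show ?thesis
    using assms xy by auto
qed

text \<open>When one position is removed from a \<open>3 * 3\<close> grid, each other position lies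
  on a full line, horizontal or vertical, that avoids it. Full lines of different directions cross,
  and parallel ones are joined by a full line across them.\<close>

lemma nine_linked:
  assumes adj: "adjacent_linked k"
    and good: "\<And>a b. a < 3 \<Longrightarrow> b < 3 \<Longrightarrow> (a, b) \<noteq> (a0, b0) \<Longrightarrow> good k (3 * i + a) (3 * j + b)"
    and abcd: "a < 3" "b < 3" "c < 3" "d < 3" "(a, b) \<noteq> (a0, b0)" "(c, d) \<noteq> (a0, b0)"
  shows "R (rep k (3 * i + a, 3 * j + b)) (rep k (3 * i + c, 3 * j + d))"
proof -
  define r where "r a b = rep k (3 * i + a, 3 * j + b)" for a b
  have row: "R (r a b) (r a b')" if "a \<noteq> a0" "a < 3" "b < 3" "b' < 3" for a b b'
  proof -
    have gd: "good k (3 * i + a) (3 * j + b)" if "b < 3" for b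
      using good that \<open>a \<noteq> a0\<close> \<open>a < 3\<close> by auto
    have *: "R (r a 0) (r a 1)" "R (r a 1) (r a 2)"
      using adjacent_linkedD(2)[OF adj gd[of 0]] adjacent_linkedD(2)[OF adj gd[of 1]] gd[of 1] gd[of 2]
      by (auto simp: r_def numeral_2_eq_2)
    show ?thesis
      using three_linked[of "r a", OF _ *] rep_refl[OF gd] that by (simp add: r_def)
  qed
  have col: "R (r a b) (r a' b)" if "b \<noteq> b0" "b < 3" "a < 3" "a' < 3" for a a' b
  proof -
    have gd: "good k (3 * i + a) (3 * j + b)" if "a < 3" for a
      using good that \<open>b \<noteq> b0\<close> \<open>b < 3\<close> by auto
    have *: "R (r 0 b) (r 1 b)" "R (r 1 b) (r 2 b)"
      using adjacent_linkedD(1)[OF adj gd[of 0]] adjacent_linkedD(1)[OF adj gd[of 1]] gd[of 1] gd[of 2]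
      by (auto simp: r_def numeral_2_eq_2)
    show ?thesis
      using three_linked[of "\<lambda>a. r a b", OF _ *] rep_refl[OF gd] that by (simp add: r_def)
  qed
  have other: "\<exists>n<3. n \<noteq> n0" for n0 :: nat
    by (cases "n0 = 0") (auto intro: exI[of _ 0] exI[of _ 1])
  obtain a1 where a1: "a1 < 3" "a1 \<noteq> a0" using other by blast
  obtain b1 where b1: "b1 < 3" "b1 \<noteq> b0" using other by blast
  consider "a \<noteq> a0" "c \<noteq> a0" | "a \<noteq> a0" "d \<noteq> b0" | "b \<noteq> b0" "c \<noteq> a0" | "b \<noteq> b0" "d \<noteq> b0"
    using abcd by auto
  then have "R (r a b) (r c d)"
  proof cases
    case 1
    then show ?thesis
      using row[of a b b1] col[of b1 a c] row[of c b1 d] abcd b1 link_trans by blast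
  next
    case 2
    then show ?thesis
      using row[of a b d] col[of d a c] abcd link_trans by blast
  next
    case 3
    then show ?thesis
      using col[of b a c] row[of c b d] abcd link_trans by blast
  next
    case 4
    then show ?thesis
      using col[of b a a1] row[of a1 b d] col[of d a1 c] abcd a1 link_trans by blast
  qed
  then show ?thesis by (simp add: r_def)
qed

text \<open>The exception granted by goodness may itself be good, and then be one of the two
  positions to link. In that case a position different from both takes over its role.\<close>

lemma sub_linked:
  assumes adj: "adjacent_linked k"
    and "good (Suc k) i j" and abcd: "a < 3" "b < 3" "c < 3" "d < 3"
    and g: "good k (3 * i + a) (3 * j + b)" "good k (3 * i + c) (3 * j + d)"
  shows "R (rep k (3 * i + a, 3 * j + b)) (rep k (3 * i + c, 3 * j + d))"
proof -
  obtain a0 b0 where "\<forall>a<3. \<forall>b<3. (a, b) \<noteq> (a0, b0) \<longrightarrow> good k (3 * i + a) (3 * j + b)"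
    using assms(2) by auto
  then have good: "good k (3 * i + a) (3 * j + b)" if "a < 3" "b < 3" "(a, b) \<noteq> (a0, b0)" for a b
    using that by blast
  show ?thesis
  proof (cases "good k (3 * i + a0) (3 * j + b0)")
    case True
    \<comment> \<open>All nine sub-blocks are good, so any other one may play the role of the exception.\<close>
    then have all: "good k (3 * i + x) (3 * j + y)" if "x < 3" "y < 3" for x y
      using good[OF that] by auto
    have "\<exists>y<3. y \<noteq> b \<and> y \<noteq> d"
      by presburger
    then obtain y where "y < 3" "y \<noteq> b" "y \<noteq> d" by blast
    then show ?thesis
      using nine_linked[where ?a0.0 = 0 and ?b0.0 = y, OF adj _ abcd] all by blast
  next
    case False
    then have "(a, b) \<noteq> (a0, b0)" "(c, d) \<noteq> (a0, b0)"
      using g by auto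
    then show ?thesis
      using nine_linked[OF adj good abcd] by blast
  qed
qed

text \<open>The representative of a good block is the representative of one of its good sub-blocks,
  so \<open>sub_linked\<close> applies.\<close>

lemma sub_linked_rep:
  assumes adj: "adjacent_linked k"
    and g: "good (Suc k) i j" and ab: "a < 3" "b < 3" "good k (3 * i + a) (3 * j + b)"
  shows "R (rep k (3 * i + a, 3 * j + b)) (rep (Suc k) (i, j))"
proof -
  define w where "w = (SOME w. fst w div 3 = i \<and> snd w div 3 = j \<and> good k (fst w) (snd w))"
  have w: "fst w div 3 = i \<and> snd w div 3 = j \<and> good k (fst w) (snd w)"
    unfolding w_def by (rule good_Suc_witness) fact
  \<comment> \<open>The remainders modulo 3 recover the offsets of the chosen sub-block, as
    \<open>sub_linked\<close> expects them.\<close>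
  have w': "3 * i + fst w mod 3 = fst w" "3 * j + snd w mod 3 = snd w"
    using w by (auto simp: mult.commute)
  have "R (rep k (3 * i + a, 3 * j + b)) (rep k (3 * i + fst w mod 3, 3 * j + snd w mod 3))"
    using w by (intro sub_linked[OF adj g] ab) (auto simp: w')
  moreover have "rep (Suc k) (i, j) = rep k w"
    by (simp add: w_def)
  ultimately show ?thesis
    by (simp add: w')
qed

text \<open>Three pairs of sub-blocks face each other across the common side of two neighbouring
  blocks. The two exceptions spoil at most two pairs, and the remaining pair is linked by the
  induction hypothesis; \<open>sub_linked_rep\<close> extends this link to the representatives of
  both blocks.\<close>

lemma rep_adjacent: "adjacent_linked k"
proof (induction k)
  case 0
  then show ?case using link_right link_up by (simp add: adjacent_linked_def)
next
  case (Suc k)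
  note sub = sub_linked_rep[OF Suc.IH]
  have third: "\<exists>n<3. n \<noteq> x \<and> n \<noteq> y" for x y :: nat
    by presburger
  have exc: "\<exists>a0 b0. \<forall>a<3. \<forall>b<3. (a, b) \<noteq> (a0, b0) \<longrightarrow> good k (3 * i + a) (3 * j + b)"
    if "good (Suc k) i j" for i j
    using that by auto
  show ?case
    unfolding adjacent_linked_def
  proof (intro conjI impI allI)
    fix i j
    assume g: "good (Suc k) i j" "good (Suc k) (Suc i) j"
    obtain a0 b0 where 0: "\<forall>a<3. \<forall>b<3. (a, b) \<noteq> (a0, b0) \<longrightarrow> good k (3 * i + a) (3 * j + b)"
      using exc[OF g(1)] by blast
    obtain a1 b1 where 1: "\<forall>a<3. \<forall>b<3. (a, b) \<noteq> (a1, b1) \<longrightarrow> good k (3 * Suc i + a) (3 * j + b)"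
      using exc[OF g(2)] by blast
    obtain b where b: "b < 3" "b \<noteq> b0" "b \<noteq> b1" using third by blast
    have gg: "good k (3 * i + 2) (3 * j + b)" "good k (3 * Suc i + 0) (3 * j + b)"
      using 0[rule_format, of 2 b] 1[rule_format, of 0 b] b by simp_all
    have "R (rep k (3 * i + 2, 3 * j + b)) (rep k (3 * Suc i + 0, 3 * j + b))"
      using adjacent_linkedD(1)[OF Suc.IH gg(1)] gg(2) by (simp add: eval_nat_numeral)
    moreover have "R (rep k (3 * i + 2, 3 * j + b)) (rep (Suc k) (i, j))"
      by (rule sub[OF g(1) _ b(1) gg(1)]) simp
    moreover have "R (rep k (3 * Suc i + 0, 3 * j + b)) (rep (Suc k) (Suc i, j))"
      by (rule sub[OF g(2) _ b(1) gg(2)]) simp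
    ultimately show "R (rep (Suc k) (i, j)) (rep (Suc k) (Suc i, j))"
      by (blast intro: link_sym link_trans)
  next
    fix i j
    assume g: "good (Suc k) i j" "good (Suc k) i (Suc j)"
    obtain a0 b0 where 0: "\<forall>a<3. \<forall>b<3. (a, b) \<noteq> (a0, b0) \<longrightarrow> good k (3 * i + a) (3 * j + b)"
      using exc[OF g(1)] by blast
    obtain a1 b1 where 1: "\<forall>a<3. \<forall>b<3. (a, b) \<noteq> (a1, b1) \<longrightarrow> good k (3 * i + a) (3 * Suc j + b)"
      using exc[OF g(2)] by blast
    obtain a where a: "a < 3" "a \<noteq> a0" "a \<noteq> a1" using third by blast
    have gg: "good k (3 * i + a) (3 * j + 2)" "good k (3 * i + a) (3 * Suc j + 0)"
      using 0[rule_format, of a 2] 1[rule_format, of a 0] a by simp_all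
    have "R (rep k (3 * i + a, 3 * j + 2)) (rep k (3 * i + a, 3 * Suc j + 0))"
      using adjacent_linkedD(2)[OF Suc.IH gg(1)] gg(2) by (simp add: eval_nat_numeral)
    moreover have "R (rep k (3 * i + a, 3 * j + 2)) (rep (Suc k) (i, j))"
      by (rule sub[OF g(1) a(1) _ gg(1)]) simp
    moreover have "R (rep k (3 * i + a, 3 * Suc j + 0)) (rep (Suc k) (i, Suc j))"
      by (rule sub[OF g(2) a(1) _ gg(2)]) simp
    ultimately show "R (rep (Suc k) (i, j)) (rep (Suc k) (i, Suc j))"
      by (blast intro: link_sym link_trans)
  qed
qed

text \<open>The corner block of level \<open>k\<close> is a sub-block of the corner block of level
  \<open>Suc k\<close>, so all their representatives from level \<open>k0\<close> on are linked.
  Each corner block also contains linked good sub-blocks far from the corner.\<close>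

lemma infinite_cluster:
  assumes "\<And>k. k \<ge> k0 \<Longrightarrow> good k 0 0"
  shows "\<exists>v. \<forall>m. \<exists>i j. occ i j \<and> R v (i, j) \<and> i \<ge> m"
proof (intro exI[of _ "rep k0 (0, 0)"] allI)
  note sub = sub_linked_rep[OF rep_adjacent]
  have chain: "R (rep k0 (0, 0)) (rep k (0, 0))" if "k \<ge> k0" for k
    using that
  proof (induction k rule: dec_induct)
    case base
    show ?case by (rule rep_refl[OF assms]) simp
  next
    case (step k)
    have "good (Suc k) 0 0" "good k 0 0"
      using assms[of k] assms[of "Suc k"] step.hyps by (simp_all del: good_block.simps)
    then have "R (rep k (0, 0)) (rep (Suc k) (0, 0))"
      using sub[of k 0 0 0 0] by (simp del: rep.simps good_block.simps)
    then show ?case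
      using step.IH link_trans by blast
  qed
  fix m
  define k where "k = max k0 m"
  have g: "good (Suc k) 0 0" "good k 0 0"
    using assms[of k] assms[of "Suc k"] by (simp_all add: k_def del: good_block.simps)
  obtain a0 b0 where *: "\<forall>a<3. \<forall>b<3. (a, b) \<noteq> (a0, b0) \<longrightarrow> good k (3 * 0 + a) (3 * 0 + b)"
    using g(1) unfolding good_block.simps by blast
  have "\<exists>b<3. b \<noteq> b0" by presburger
  then obtain b where b: "b < 3" "b \<noteq> b0" by blast
  \<comment> \<open>Offset 2 in the first coordinate puts the representative beyond
    \<open>3 ^ k\<close>, hence beyond \<open>m\<close>; the choice of \<open>b\<close> avoids the
    exception.\<close>
  have g2: "good k (3 * 0 + 2) (3 * 0 + b)"
    using *[rule_format, of 2 b] b by (simp del: good_block.simps)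
  obtain i j where ij: "rep k (3 * 0 + 2, 3 * 0 + b) = (i, j)" by fastforce
  have "R (rep k (3 * 0 + 2, 3 * 0 + b)) (rep (Suc k) (0, 0))"
    by (rule sub[OF g(1) _ b(1) g2]) simp
  then have "R (rep k0 (0, 0)) (i, j)"
    using link_trans[OF chain[of "Suc k"] link_sym] ij by (simp add: k_def del: rep.simps)
  moreover have "occ i j" "i div 3 ^ k = 2"
    using rep_occ[OF g2] ij by auto
  moreover have "m \<le> i"
  proof -
    have "m < 2 ^ m" by (rule less_exp)
    also have "(2::nat) ^ m \<le> 3 ^ m" by (rule power_mono) auto
    also have "\<dots> \<le> 3 ^ k" by (rule power_increasing) (auto simp: k_def)
    also have "\<dots> \<le> i" using \<open>i div 3 ^ k = 2\<close> by (metis div_less not_le zero_neq_numeral)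
    finally show ?thesis by simp
  qed
  ultimately show "\<exists>i j. occ i j \<and> R (rep k0 (0, 0)) (i, j) \<and> m \<le> i" by blast
qed

end

section \<open>Self-avoiding walks\<close>

text \<open>The list is written backwards: the walk starts at its last entry \<open>v\<close> and is
  prolonged at the head. The number \<open>n\<close> counts steps, so there are \<open>Suc n\<close>
  sites.\<close>

definition walks :: "('a \<Rightarrow> 'a set) \<Rightarrow> nat \<Rightarrow> 'a \<Rightarrow> 'a list set" where
  "walks nb n v = {p. length p = Suc n \<and> last p = v \<and> distinct p \<and> successively (\<lambda>w u. w \<in> nb u) p}"

lemma walks_0: "walks nb 0 v = {[v]}"
  by (auto simp: walks_def length_Suc_conv)

lemma walks_Suc_subset: "walks nb (Suc n) v \<subseteq> (\<Union>p\<in>walks nb n v. (\<lambda>w. w # p) ` nb (hd p))"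
proof
  fix q assume q: "q \<in> walks nb (Suc n) v"
  then obtain w p where wp: "q = w # p" "p \<noteq> []"
    by (auto simp: walks_def length_Suc_conv)
  then have "p \<in> walks nb n v" "w \<in> nb (hd p)"
    using q by (auto simp: walks_def successively_Cons)
  then show "q \<in> (\<Union>p\<in>walks nb n v. (\<lambda>w. w # p) ` nb (hd p))"
    using wp(1) by blast
qed

lemma finite_walks:
  assumes "\<And>v. finite (nb v)"
  shows "finite (walks nb n v)"
proof (induction n)
  case (Suc n)
  then show ?case
    using assms by (intro finite_subset[OF walks_Suc_subset]) auto
qed (simp add: walks_0)

lemma card_walks:
  assumes "\<And>v. finite (nb v)" "\<And>v. card (nb v) \<le> D"
  shows "card (walks nb n v) \<le> D ^ n"
proof (induction n)
  case (Suc n)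
  have fin: "finite (\<Union>p\<in>walks nb n v. (\<lambda>w. w # p) ` nb (hd p))"
    by (intro finite_UN_I finite_imageI finite_walks assms(1))
  have "card (walks nb (Suc n) v) \<le> (\<Sum>p\<in>walks nb n v. card ((\<lambda>w. w # p) ` nb (hd p)))"
    using card_mono[OF fin walks_Suc_subset]
      card_UN_le[OF finite_walks[where nb = nb and n = n and v = v, OF assms(1)],
        of "\<lambda>p. (\<lambda>w. w # p) ` nb (hd p)"]
    by linarith
  also have "\<dots> \<le> (\<Sum>p\<in>walks nb n v. D)"
    using assms by (intro sum_mono order_trans[OF card_image_le])
  also have "\<dots> \<le> D ^ Suc n"
    using Suc by simp
  finally show ?case .
qed (simp add: walks_0)

text \<open>A nonempty suffix keeps the starting point. This serves both to erase loops and to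
  shorten a walk to a prescribed length.\<close>

lemma walks_suffix:
  assumes "us @ p \<in> walks nb m v" "p \<noteq> []"
  shows "p \<in> walks nb (length p - 1) v"
  using assms by (auto simp: walks_def successively_append_iff)

text \<open>Each reachable site is the end of an occupied self-avoiding walk from \<open>v\<close>.
  A walk with \<open>n\<close> or more steps would contain one with exactly \<open>n\<close> steps,
  so the cluster consists of ends of finitely many short walks.\<close>

lemma finite_cluster:
  assumes fin: "\<And>v. finite (nb v)"
    and "v \<in> occ" and no: "\<And>p. p \<in> walks nb n v \<Longrightarrow> \<not> set p \<subseteq> occ"
  shows "finite ({(u, w). w \<in> nb u \<and> w \<in> occ}\<^sup>* `` {v})"
proof -
  define Rel where "Rel = {(u, w). w \<in> nb u \<and> w \<in> occ}"
  have walk: "\<exists>m. \<exists>p\<in>walks nb m v. hd p = w \<and> set p \<subseteq> occ" if "(v, w) \<in> Rel\<^sup>*" for w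
    using that
  proof (induction rule: rtrancl_induct)
    case base
    show ?case using \<open>v \<in> occ\<close> by (intro exI[of _ 0]) (simp add: walks_0)
  next
    case (step y z)
    then obtain m p where p: "p \<in> walks nb m v" "hd p = y" "set p \<subseteq> occ" by blast
    show ?case
    proof (cases "z \<in> set p")
      case True
      \<comment> \<open>The site \<open>z\<close> is revisited: cutting the list back to its earlier
        visit erases the loop.\<close>
      then obtain us ws where "p = us @ z # ws" by (meson split_list)
      then show ?thesis
        using walks_suffix[of us "z # ws" nb m v] p
        by (intro exI[of _ "length (z # ws) - 1"] bexI[of _ "z # ws"]) auto
    next
      case False
      have "z \<in> nb (hd p)" "z \<in> occ"
        using step.hyps(2) p(2) by (simp_all add: Rel_def)
      moreover have "p \<noteq> []" using p(1) by (auto simp: walks_def)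
      ultimately have "z # p \<in> walks nb (Suc m) v" "set (z # p) \<subseteq> occ"
        using p False by (simp_all add: walks_def successively_Cons)
      then show ?thesis by (intro exI[of _ "Suc m"] bexI[of _ "z # p"]) auto
    qed
  qed
  have short: "m < n" if "p \<in> walks nb m v" "set p \<subseteq> occ" for m p
  proof (rule ccontr)
    assume "\<not> m < n"
    then have len: "length (drop (m - n) p) = Suc n"
      using that by (simp add: walks_def)
    then have "drop (m - n) p \<noteq> []" by auto
    then have "drop (m - n) p \<in> walks nb n v"
      using walks_suffix[of "take (m - n) p" "drop (m - n) p" nb m v] that(1)
      unfolding len append_take_drop_id by simp
    from no[OF this] show False
      using that(2) set_drop_subset[of "m - n" p] by (meson subset_trans)
  qed
  have "Rel\<^sup>* `` {v} \<subseteq> (\<Union>m<n. hd ` walks nb m v)"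
    proof
    fix w assume "w \<in> Rel\<^sup>* `` {v}"
    then obtain m p where "p \<in> walks nb m v" "hd p = w" "set p \<subseteq> occ"
      using walk by blast
    then show "w \<in> (\<Union>m<n. hd ` walks nb m v)"
      using short by blast
  qed
  then show ?thesis
    unfolding Rel_def[symmetric] by (rule finite_subset) (simp add: finite_walks fin)
qed

section \<open>Cells, sticks and void probabilities\<close>

text \<open>Half-open boxes, so that for positive side lengths every point lies in exactly one
  cell.\<close>

definition cell :: "real ^ 'n \<Rightarrow> int ^ 'n \<Rightarrow> (real ^ 'n) set" where
  "cell s v = {x. \<forall>i. s $ i * of_int (v $ i) \<le> x $ i \<and> x $ i < s $ i * (of_int (v $ i) + 1)}"

lemma mem_cell_iff:
  assumes "\<And>i. 0 < s $ i"
  shows "x \<in> cell s v \<longleftrightarrow> v = (\<chi> i. \<lfloor>x $ i / s $ i\<rfloor>)"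
proof -
  have "s $ i * of_int (v $ i) \<le> x $ i \<and> x $ i < s $ i * (of_int (v $ i) + 1) \<longleftrightarrow>
      v $ i = \<lfloor>x $ i / s $ i\<rfloor>" for i
    using assms[of i] by (auto simp: floor_eq_iff eq_commute[of "v $ i"] field_simps)
  then show ?thesis
    by (auto simp: cell_def vec_eq_iff)
qed

lemma disjoint_cells:
  assumes "\<And>i. 0 < s $ i" "v \<noteq> w"
  shows "cell s v \<inter> cell s w = {}"
  using assms by (auto simp: mem_cell_iff)

lemma cell_nonempty:
  assumes "\<And>i. 0 < s $ i"
  shows "cell s v \<noteq> {}"
proof -
  have "(\<chi> i. s $ i * of_int (v $ i)) \<in> cell s v"
    using assms by (auto simp: cell_def)
  then show ?thesis by blast
qed

lemma cell_borel [measurable]: "cell s v \<in> sets borel"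
proof -
  have "cell s v = (\<Inter>i. {x. s $ i * of_int (v $ i) \<le> x $ i} \<inter> {x. x $ i < s $ i * (of_int (v $ i) + 1)})"
    by (auto simp: cell_def)
  also have "\<dots> \<in> sets borel"
    by (intro sets.countable_INT'' sets.Int) (auto intro!: borel_closed borel_open closed_Collect_le open_Collect_less continuous_on_component)
  finally show ?thesis .
qed

text \<open>The cell lies between an open and a closed box of equal volume.\<close>

lemma emeasure_cell:
  fixes s :: "real ^ 'n"
  assumes s: "\<And>i. 0 < s $ i"
  shows "emeasure lborel (cell s v) = ennreal (\<Prod>i\<in>UNIV. s $ i)"
proof -
  define a where "a = (\<chi> i. s $ i * of_int (v $ i))"
  define b where "b = (\<chi> i. s $ i * (of_int (v $ i) + 1))"
  have ab: "a $ i \<le> b $ i" "b $ i - a $ i = s $ i" for i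
    using s[of i] by (auto simp: a_def b_def algebra_simps)
  have "cbox a b \<noteq> {}"
    using ab(1) by (simp add: interval_ne_empty_cart)
  then have "measure lborel (cbox a b) = (\<Prod>i\<in>UNIV. s $ i)"
    by (simp add: content_cbox_cart ab(2))
  then have cb: "emeasure lborel (cbox a b) = ennreal (\<Prod>i\<in>UNIV. s $ i)"
    using emeasure_eq_ennreal_measure[of lborel "cbox a b"] emeasure_lborel_cbox_finite[of a b] by simp
  have "emeasure lborel (box a b) = emeasure lborel (cbox a b)"
    by (simp add: emeasure_lborel_box_eq emeasure_lborel_cbox_eq)
  moreover have "box a b \<subseteq> cell s v" "cell s v \<subseteq> cbox a b"
    by (auto simp: cell_def mem_box_cart a_def b_def less_imp_le)
  ultimately show ?thesis
    using emeasure_mono[of "box a b" "cell s v" lborel] emeasure_mono[of "cell s v" "cbox a b" lborel] cb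
    by (simp add: order_antisym)
qed

section \<open>Void and occupation probabilities of a Poisson process\<close>

lemma num_points_eq_0_iff: "num_points A \<omega> = 0 \<longleftrightarrow> \<omega> \<inter> A = {}"
  by (simp add: num_points_def emeasure_count_space_eq_0)

lemma poisson_measurable:
  assumes "poisson_process M \<mu>" "A \<in> sets \<mu>"
  shows "num_points A \<in> borel_measurable M"
proof -
  have "\<forall>A\<in>sets \<mu>. num_points A \<in> borel_measurable M"
    using assms(1) unfolding poisson_process_def by (elim conjE)
  then show ?thesis using assms(2) ..
qed

lemma poisson_void_probability:
  assumes "poisson_process M \<mu>" "A \<in> sets \<mu>" "emeasure \<mu> A = ennreal m" "0 \<le> m"
  shows "measure M {\<omega> \<in> space M. num_points A \<omega> = 0} = exp (- m)"
proof -
  have "measure \<mu> A = m"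
    using assms by (simp add: measure_def)
  moreover have "\<forall>A\<in>sets \<mu>. emeasure \<mu> A < \<infinity> \<longrightarrow>
        (\<forall>k::nat. measure M {\<omega> \<in> space M. num_points A \<omega> = of_nat k}
                  = exp (- measure \<mu> A) * measure \<mu> A ^ k / fact k)"
    using assms(1) unfolding poisson_process_def by (elim conjE)
  from this[rule_format, OF assms(2), of 0]
  have "measure M {\<omega> \<in> space M. num_points A \<omega> = 0} = exp (- measure \<mu> A)"
    using assms(3) by simp
  ultimately show ?thesis by simp
qed

lemma poisson_occupied_probability:
  assumes pp: "poisson_process M \<mu>" and F: "finite F" "F \<subseteq> sets \<mu>" "disjoint F"
    and m: "\<And>A. A \<in> F \<Longrightarrow> emeasure \<mu> A = ennreal m" "0 \<le> m"
  shows "measure M {\<omega> \<in> space M. \<forall>A\<in>F. num_points A \<omega> \<noteq> 0} = (1 - exp (- m)) ^ card F"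
\<comment> \<open>The product formula for independent variables is applied to nonempty index sets,
  so the empty family is treated separately.\<close>
proof (cases "F = {}")
  case True
  have "prob_space M" using pp by (simp add: poisson_process_def)
  then show ?thesis using True by (simp add: prob_space.prob_space)
next
  case False
  interpret prob_space M using pp by (simp add: poisson_process_def)
  have meas: "num_points A \<in> borel_measurable M" if "A \<in> F" for A
    by (rule poisson_measurable[OF pp]) (use F(2) that in blast)
  have indep: "indep_vars (\<lambda>_. borel) num_points F"
  proof -
    have "\<forall>F. finite F \<and> F \<subseteq> sets \<mu> \<and> disjoint F \<longrightarrow> indep_vars (\<lambda>_. borel) num_points F"
      using pp unfolding poisson_process_def by (elim conjE)
    then show ?thesis using F by simp
  qed
  have one: "prob (num_points A -` (- {0}) \<inter> space M) = 1 - exp (- m)" if "A \<in> F" for A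
  proof -
    have eq: "num_points A -` (- {0}) \<inter> space M = space M - {\<omega> \<in> space M. num_points A \<omega> = 0}"
      by auto
    have "{\<omega> \<in> space M. num_points A \<omega> = 0} \<in> events"
      using meas[OF that] by measurable
    then show ?thesis
      using poisson_void_probability[OF pp _ m(1)[OF that] m(2)] F(2) that
      by (simp add: eq prob_compl subset_iff)
  qed
  have "{\<omega> \<in> space M. \<forall>A\<in>F. num_points A \<omega> \<noteq> 0} = (\<Inter>A\<in>F. num_points A -` (- {0}) \<inter> space M)"
    using False by auto
  also have "prob \<dots> = (\<Prod>A\<in>F. prob (num_points A -` (- {0}) \<inter> space M))"
    using indep_varsD[OF indep False F(1) subset_refl] by simp
  also have "\<dots> = (1 - exp (- m)) ^ card F"
    using one by simp
  finally show ?thesis .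
qed

section \<open>The intensity measure of the rigid model\<close>

lemma sets_rigid_orientation: "sets (rigid_orientation :: (real ^ 'n::{finite,linorder}) measure) =
    sets (restrict_space borel (sphere 0 1))"
  and space_rigid_orientation: "space (rigid_orientation :: (real ^ 'n::{finite,linorder}) measure) = sphere 0 1"
  by (simp_all add: rigid_orientation_def space_restrict_space)

lemma e2_sphere: "(e2 :: real ^ 'n::{finite,linorder}) \<in> sphere 0 1"
  by (simp add: e2_def norm_axis_1)

lemma emeasure_rigid_orientation:
  assumes "B \<in> sets (restrict_space borel (sphere 0 1))"
  shows "emeasure (rigid_orientation :: (real ^ 'n::{finite,linorder}) measure) B = indicator B e2"
  using assms by (simp add: rigid_orientation_def)

lemma stick_intensity_times:
  fixes B :: "(real ^ 'n::{finite,linorder}) set"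
  assumes A: "A \<in> sets borel" and B: "B \<in> sets borel" "B \<subseteq> sphere 0 1"
  shows "A \<times> B \<in> sets (stick_intensity lam rigid_orientation)"
    and "emeasure (stick_intensity lam rigid_orientation) (A \<times> B) =
      ennreal lam * (emeasure lborel A * indicator B e2)"
proof -
  interpret R: prob_space "rigid_orientation :: (real, 'n) vec measure"
    unfolding rigid_orientation_def using e2_sphere
    by (intro prob_space_return) (simp add: space_restrict_space)
  have B': "B \<in> sets (restrict_space borel (sphere 0 1))"
    using B by (simp add: sets_restrict_space_iff)
  then have B'': "B \<in> sets (rigid_orientation :: (real, 'n) vec measure)"
    by (simp add: sets_rigid_orientation)
  show "A \<times> B \<in> sets (stick_intensity lam rigid_orientation)"
    using A B'' by (simp add: stick_intensity_def)
  show "emeasure (stick_intensity lam rigid_orientation) (A \<times> B) =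
      ennreal lam * (emeasure lborel A * indicator B e2)"
    using A B'' B' by (simp add: stick_intensity_def R.emeasure_pair_measure_Times emeasure_rigid_orientation)
qed

section \<open>Geometry of sticks\<close>

text \<open>The axis segment is compact and nonempty, so the distance to it is attained.\<close>

lemma mem_stick_iff:
  assumes "0 \<le> L"
  shows "y \<in> stick x p L \<longleftrightarrow> (\<exists>t. \<bar>t\<bar> \<le> L / 2 \<and> norm (y - (x + t *\<^sub>R p)) \<le> 1)"
proof -
  have seg: "axis_segment x p L = (\<lambda>t. x + t *\<^sub>R p) ` {- L / 2..L / 2}"
    by (auto simp: axis_segment_def)
  have "compact (axis_segment x p L)"
    unfolding seg by (intro compact_continuous_image continuous_intros compact_Icc)
  then have cl: "closed (axis_segment x p L)" by (rule compact_imp_closed)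
  have ne: "axis_segment x p L \<noteq> {}"
    using assms unfolding seg by auto
  have "infdist y (axis_segment x p L) \<le> 1 \<longleftrightarrow> (\<exists>z\<in>axis_segment x p L. dist y z \<le> 1)"
    using infdist_attains_inf[OF cl ne, of y] infdist_le2 by metis
  moreover have "t \<in> {- L / 2..L / 2} \<longleftrightarrow> \<bar>t\<bar> \<le> L / 2" for t
    by auto
  ultimately show ?thesis
    unfolding stick_def mem_Collect_eq seg by (simp add: dist_norm Bex_def del: atLeastAtMost_iff)
qed

text \<open>A stick is the Minkowski sum of a segment and the unit ball, hence convex.\<close>

lemma connected_stick:
  assumes "0 \<le> L"
  shows "connected (stick x p L)"
proof -
  have "convex (axis_segment x p L)"
  proof -
    have "axis_segment x p L = (+) x ` (\<lambda>t. t *\<^sub>R p) ` {- L / 2..L / 2}"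
      unfolding image_image by (auto simp: axis_segment_def)
    moreover have "convex ((\<lambda>t. t *\<^sub>R p) ` {- L / 2..L / 2})"
      by (intro convex_linear_image linear_scaleR_left convex_real_interval)
    ultimately show ?thesis by (simp add: convex_translation)
  qed
  then have "convex (\<Union>z\<in>axis_segment x p L. \<Union>u\<in>cball 0 1. {z + u})"
    by (intro convex_sums) auto
  moreover have "stick x p L = (\<Union>z\<in>axis_segment x p L. \<Union>u\<in>cball 0 1. {z + u})"
  proof (intro set_eqI iffI)
    fix y assume "y \<in> stick x p L"
    then obtain t where t: "\<bar>t\<bar> \<le> L / 2" "norm (y - (x + t *\<^sub>R p)) \<le> 1"
      using mem_stick_iff[OF assms] by blast
    have "x + t *\<^sub>R p \<in> axis_segment x p L"
      using t(1) by (auto simp: axis_segment_def)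
    then show "y \<in> (\<Union>z\<in>axis_segment x p L. \<Union>u\<in>cball 0 1. {z + u})"
      using t(2) by (intro UN_I[of "x + t *\<^sub>R p"] UN_I[of "y - (x + t *\<^sub>R p)"]) auto
  next
    fix y assume "y \<in> (\<Union>z\<in>axis_segment x p L. \<Union>u\<in>cball 0 1. {z + u})"
    then obtain t u where "- L / 2 \<le> t" "t \<le> L / 2" "y = x + t *\<^sub>R p + u" "norm u \<le> 1"
      by (auto simp: axis_segment_def)
    then show "y \<in> stick x p L"
      unfolding mem_stick_iff[OF assms] by (intro exI[of _ t]) auto
  qed
  ultimately show ?thesis
    by (simp add: convex_connected)
qed

lemma center_in_stick: "0 \<le> L \<Longrightarrow> x \<in> stick x p L"
  unfolding mem_stick_iff by (intro exI[of _ 0]) simp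

text \<open>The midpoint of the two centres lies in both sticks: moving along each axis by half of
  \<open>r\<close> towards the other centre leaves half of a vector of norm at most 2.\<close>

lemma parallel_sticks_meet:
  assumes "0 \<le> L" "\<bar>r\<bar> \<le> L" "norm (x' - x - r *\<^sub>R p) \<le> 2"
  shows "stick x p L \<inter> stick x' p L \<noteq> {}"
proof -
  define y where "y = (1/2) *\<^sub>R (x + x')"
  have "y - (x + (r / 2) *\<^sub>R p) = (1/2) *\<^sub>R (x' - x - r *\<^sub>R p)"
    by (simp add: y_def algebra_simps flip: scaleR_add_left)
  then have 1: "y \<in> stick x p L"
    unfolding mem_stick_iff[OF assms(1)] using assms by (intro exI[of _ "r / 2"]) auto
  have "y - (x' + (- r / 2) *\<^sub>R p) = - (1/2) *\<^sub>R (x' - x - r *\<^sub>R p)"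
    by (simp add: y_def algebra_simps flip: scaleR_add_left)
  then have "y \<in> stick x' p L"
    unfolding mem_stick_iff[OF assms(1)] using assms by (intro exI[of _ "- r / 2"]) auto
  with 1 show ?thesis by blast
qed

text \<open>The percolation event is only enclosed in a null set; passing to the completion makes it
  measurable.\<close>

lemma measure_completion_subset_null:
  assumes "E \<subseteq> N" "N \<in> null_sets M"
  shows "measure (completion M) E = 0"
proof -
  have "E \<in> null_sets (completion M)"
    using null_sets_completion_subset[OF assms(1)] assms(2) null_sets_completionI by blast
  then show ?thesis
    by (simp add: measure_def null_setsD1)
qed

lemma measure_completion_AE:
  assumes "prob_space M" "AE \<omega> in M. Q \<omega>"
  shows "measure (completion M) {\<omega> \<in> space M. Q \<omega>} = 1"
proof -
  interpret prob_space M by fact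
  obtain N where N: "{\<omega> \<in> space M. \<not> Q \<omega>} \<subseteq> N" "N \<in> null_sets M"
    using assms(2) by (auto simp: eventually_ae_filter)
  have null: "{\<omega> \<in> space M. \<not> Q \<omega>} \<in> null_sets (completion M)"
    using null_sets_completion_subset[OF N(1)] N(2) null_sets_completionI by blast
  have eq: "{\<omega> \<in> space M. Q \<omega>} = space (completion M) - {\<omega> \<in> space M. \<not> Q \<omega>}"
    by auto
  have "emeasure (completion M) {\<omega> \<in> space M. Q \<omega>} = emeasure (completion M) (space (completion M))"
    unfolding eq using null by (intro emeasure_Diff_null_set) auto
  also have "\<dots> = 1"
    using emeasure_completion[of "space M" M] by (simp add: emeasure_space_1)
  finally show ?thesis by (simp add: measure_def)
qed

lemma emeasure_Union_cells:
  assumes s: "\<And>i. 0 < s $ i" and V: "finite V"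
  shows "emeasure lborel (\<Union>v\<in>V. cell s v) = ennreal (real (card V) * (\<Prod>i\<in>UNIV. s $ i))"
proof -
  have "emeasure lborel (\<Union>v\<in>V. cell s v) = (\<Sum>v\<in>V. emeasure lborel (cell s v))"
    using V disjoint_cells[OF s]
    by (intro sum_emeasure[symmetric]) (auto simp: disjoint_family_on_def)
  then show ?thesis
    by (simp add: emeasure_cell[OF s] ennreal_mult' ennreal_of_nat_eq_real_of_nat)
qed

lemma close_cells:
  assumes s: "\<And>i. 0 < s $ i" and x: "x \<in> cell s v" "x' \<in> cell s v'" and "\<bar>v $ l - v' $ l\<bar> \<le> 1"
  shows "\<bar>x' $ l - x $ l\<bar> \<le> 2 * s $ l"
proof -
  have "v $ l \<le> v' $ l + 1" "v' $ l \<le> v $ l + 1" using assms(4) by auto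
  then have "real_of_int (v $ l) \<le> v' $ l + 1" "real_of_int (v' $ l) \<le> v $ l + 1" by linarith+
  then have "s $ l * v $ l \<le> s $ l * (v' $ l + 1)" "s $ l * v' $ l \<le> s $ l * (v $ l + 1)"
    using s[of l] by (intro mult_left_mono; simp)+
  then show ?thesis
    using x unfolding cell_def mem_Collect_eq by (auto simp: algebra_simps abs_le_iff dest!: spec[of _ l])
qed

text \<open>Only points with orientation exactly \<open>e2\<close> count. For the upper bound any
  other sticks could only enlarge the covered set; for the lower bound they are excluded almost
  surely.\<close>

definition occupied :: "(real, 'n::{finite,linorder}) vec \<Rightarrow> ((real, 'n) vec \<times> (real, 'n) vec) set \<Rightarrow> (int, 'n) vec set" where
  "occupied s \<omega> = {v. \<omega> \<inter> (cell s v \<times> {e2}) \<noteq> {}}"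

lemma measurable_empty_event:
  assumes "poisson_process M \<mu>" "A \<in> sets \<mu>"
  shows "{\<omega> \<in> space M. \<omega> \<inter> A = {}} \<in> sets M" "{\<omega> \<in> space M. \<omega> \<inter> A \<noteq> {}} \<in> sets M"
proof -
  note [measurable] = poisson_measurable[OF assms]
  show "{\<omega> \<in> space M. \<omega> \<inter> A = {}} \<in> sets M" "{\<omega> \<in> space M. \<omega> \<inter> A \<noteq> {}} \<in> sets M"
    unfolding num_points_eq_0_iff[symmetric] by measurable
qed

lemma sets_marked:
  fixes A :: "(real ^ 'n::{finite,linorder}) set"
  assumes "A \<in> sets borel"
  shows "A \<times> {e2} \<in> sets (stick_intensity lam rigid_orientation)"
    and "emeasure (stick_intensity lam rigid_orientation) (A \<times> {e2}) = ennreal lam * emeasure lborel A"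
  using stick_intensity_times[OF assms, of "{e2}"] e2_sphere by auto

text \<open>Joint vacancy of cells is emptiness of their union, so a single void probability with
  added volumes gives the product.\<close>

lemma vacant_cells_probability:
  fixes s :: "real ^ 'n::{finite,linorder}"
  assumes pp: "poisson_process M (stick_intensity lam rigid_orientation)" and "0 < lam"
    and s: "\<And>i. 0 < s $ i" and V: "finite V"
  shows "{\<omega> \<in> space M. V \<inter> occupied s \<omega> = {}} \<in> sets M"
    and "measure M {\<omega> \<in> space M. V \<inter> occupied s \<omega> = {}} =
      exp (- lam * (\<Prod>i\<in>UNIV. s $ i)) ^ card V"
proof -
  define U where "U = (\<Union>v\<in>V. cell s v)"
  have "U \<in> sets borel"
    unfolding U_def using V by (intro sets.finite_UN) auto
  note U = sets_marked[OF this]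
  have eq: "{\<omega> \<in> space M. V \<inter> occupied s \<omega> = {}} = {\<omega> \<in> space M. \<omega> \<inter> (U \<times> {e2}) = {}}"
    unfolding U_def occupied_def by fast
  show "{\<omega> \<in> space M. V \<inter> occupied s \<omega> = {}} \<in> sets M"
    unfolding eq by (rule measurable_empty_event[OF pp U(1)])
  have pos: "0 < (\<Prod>i\<in>UNIV. s $ i)"
    using s by (intro prod_pos) auto
  have "emeasure (stick_intensity lam rigid_orientation) (U \<times> {e2}) =
      ennreal (lam * (real (card V) * (\<Prod>i\<in>UNIV. s $ i)))"
    unfolding U(2) unfolding U_def emeasure_Union_cells[OF s V] using \<open>0 < lam\<close> by (simp add: ennreal_mult')
  from poisson_void_probability[OF pp U(1) this]
  show "measure M {\<omega> \<in> space M. V \<inter> occupied s \<omega> = {}} =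
      exp (- lam * (\<Prod>i\<in>UNIV. s $ i)) ^ card V"
    unfolding eq num_points_eq_0_iff using pos \<open>0 < lam\<close>
    by (simp add: exp_of_nat_mult[symmetric] algebra_simps)
qed

text \<open>Distinct cells are disjoint, so their occupation events are independent.\<close>

lemma occupied_cells_probability:
  fixes s :: "real ^ 'n::{finite,linorder}"
  assumes pp: "poisson_process M (stick_intensity lam rigid_orientation)" and "0 < lam"
    and s: "\<And>i. 0 < s $ i" and V: "finite V"
  shows "{\<omega> \<in> space M. V \<subseteq> occupied s \<omega>} \<in> sets M"
    and "measure M {\<omega> \<in> space M. V \<subseteq> occupied s \<omega>} =
      (1 - exp (- lam * (\<Prod>i\<in>UNIV. s $ i))) ^ card V"
proof -
  define A where "A v = cell s v \<times> {e2 :: (real, 'n) vec}" for v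
  note A = sets_marked[OF cell_borel[of s], where lam = lam, folded A_def]
  have eq: "{\<omega> \<in> space M. V \<subseteq> occupied s \<omega>} = {\<omega> \<in> space M. \<forall>v\<in>V. \<omega> \<inter> A v \<noteq> {}}"
    unfolding A_def occupied_def subset_iff mem_Collect_eq by (simp only: Ball_def)
  show "{\<omega> \<in> space M. V \<subseteq> occupied s \<omega>} \<in> sets M"
    unfolding eq by (intro sets.sets_Collect_finite_All V measurable_empty_event[OF pp A(1)])
  \<comment> \<open>The Poisson axioms speak of a set of sets; since cells are nonempty and
    disjoint, passing to the image keeps the number of factors.\<close>
  have inj: "inj_on A V"
  proof (rule inj_onI)
    fix v w assume "A v = A w"
    then have "cell s v = cell s w" by (auto simp: A_def)
    then show "v = w"
      using disjoint_cells[OF s, of v w] cell_nonempty[OF s, of v] by auto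
  qed
  have disj: "disjoint (A ` V)"
  proof (rule disjointI)
    fix X Y assume "X \<in> A ` V" "Y \<in> A ` V" "X \<noteq> Y"
    then obtain v w where "X = A v" "Y = A w" "v \<noteq> w" by auto
    then show "X \<inter> Y = {}"
      using disjoint_cells[OF s \<open>v \<noteq> w\<close>] by (auto simp: A_def)
  qed
  have pos: "0 < (\<Prod>i\<in>UNIV. s $ i)"
    using s by (intro prod_pos) auto
  have em: "emeasure (stick_intensity lam rigid_orientation) B = ennreal (lam * (\<Prod>i\<in>UNIV. s $ i))"
    if "B \<in> A ` V" for B
    using that \<open>0 < lam\<close> by (auto simp: A(2) emeasure_cell[OF s] ennreal_mult')
  have "measure M {\<omega> \<in> space M. \<forall>B\<in>A ` V. num_points B \<omega> \<noteq> 0} =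
      (1 - exp (- (lam * (\<Prod>i\<in>UNIV. s $ i)))) ^ card (A ` V)"
  proof (rule poisson_occupied_probability[OF pp _ _ disj em])
    show "A ` V \<subseteq> sets (stick_intensity lam rigid_orientation)"
      using A(1) by (simp add: image_subset_iff)
  qed (use V pos \<open>0 < lam\<close> in simp_all)
  then show "measure M {\<omega> \<in> space M. V \<subseteq> occupied s \<omega>} =
      (1 - exp (- lam * (\<Prod>i\<in>UNIV. s $ i))) ^ card V"
    unfolding eq by (simp add: card_image[OF inj] num_points_eq_0_iff)
qed

text \<open>
  The radius is chosen so that occupied cells whose sticks can touch are near each other when the
  cells have length \<open>L\<close> in direction \<open>e2\<close> and width one in all other directions.
\<close>

definition near_cells :: "int ^ 'n \<Rightarrow> (int ^ 'n) set" where
  "near_cells v = {w. \<forall>i. \<bar>w $ i - v $ i\<bar> \<le> 4}"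

lemma card_near_cells:
  fixes v :: "int ^ 'n"
  shows "finite (near_cells v)" "card (near_cells v) \<le> 9 ^ CARD('n)"
proof -
  define F where "F = (UNIV :: 'n set) \<rightarrow>\<^sub>E {-4..4::int}"
  have F: "finite F" "card F = 9 ^ CARD('n)"
    unfolding F_def by (auto simp: card_PiE intro: finite_PiE)
  have sub: "near_cells v \<subseteq> (\<lambda>f. \<chi> i. v $ i + f i) ` F"
  proof
    fix w assume w: "w \<in> near_cells v"
    have "w $ i - v $ i \<in> {-4..4}" for i
    proof -
      have "\<bar>w $ i - v $ i\<bar> \<le> 4" using w by (simp add: near_cells_def)
      then show ?thesis by (simp only: atLeastAtMost_iff) linarith
    qed
    then have "(\<lambda>i. w $ i - v $ i) \<in> F"
      unfolding F_def PiE_UNIV_domain by (rule Pi_I)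
    moreover have "w = (\<chi> i. v $ i + (w $ i - v $ i))"
      by (simp add: vec_eq_iff)
    ultimately show "w \<in> (\<lambda>f. \<chi> i. v $ i + f i) ` F"
      using image_eqI[of w "\<lambda>f. \<chi> i. v $ i + f i" "\<lambda>i. w $ i - v $ i" F] by simp
  qed
  show "finite (near_cells v)"
    using sub F(1) finite_subset by blast
  show "card (near_cells v) \<le> 9 ^ CARD('n)"
    using card_mono[OF finite_imageI[OF F(1)] sub] card_image_le[OF F(1), of "\<lambda>f. \<chi> i. v $ i + f i"]
    unfolding F(2) by (rule order_trans)
qed

text \<open>Union bound: a self-avoiding walk of \<open>n\<close> steps visits \<open>Suc n\<close>
  distinct cells, each occupied with probability \<open>q = 1 - exp (- m)\<close>, which is at most
  \<open>m\<close>. By \<open>small\<close>, the number of walks times this probability decays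
  geometrically.\<close>

lemma long_walk_probability:
  fixes s :: "real ^ 'n::{finite,linorder}" and v :: "(int, 'n) vec"
  assumes pp: "poisson_process M (stick_intensity lam rigid_orientation)" and "0 < lam"
    and s: "\<And>i. 0 < s $ i" and small: "lam * (\<Prod>i\<in>UNIV. s $ i) * 9 ^ CARD('n) \<le> 1 / 2"
  defines "E \<equiv> \<lambda>n. {\<omega> \<in> space M. \<exists>p\<in>walks near_cells n v. set p \<subseteq> occupied s \<omega>}"
  shows "(\<Inter>n. E n) \<in> null_sets M"
proof -
  interpret prob_space M using pp unfolding poisson_process_def by (elim conjE)
  define m where "m = lam * (\<Prod>i\<in>UNIV. s $ i)"
  define q where "q = 1 - exp (- m)"
  have "0 < (\<Prod>i\<in>UNIV. s $ i)"
    using s by (intro prod_pos) auto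
  then have m: "0 \<le> m" using \<open>0 < lam\<close> by (simp add: m_def)
  have q: "0 \<le> q" "q \<le> m" "q \<le> 1"
    using m exp_ge_add_one_self[of "- m"] by (auto simp: q_def)
  note walks = finite_walks[of near_cells, OF card_near_cells(1)]
    card_walks[of near_cells, OF card_near_cells]
  have E_eq: "E n = (\<Union>p\<in>walks near_cells n v. {\<omega> \<in> space M. set p \<subseteq> occupied s \<omega>})" for n
    unfolding E_def by blast
  note occ = occupied_cells_probability[OF pp \<open>0 < lam\<close> s finite_set]
  have ev: "E n \<in> events" for n
    unfolding E_eq using walks(1) occ(1) by (intro sets.finite_UN) auto
  have bound: "prob (E n) \<le> (1 / 2) ^ n" for n
  proof -
    have "prob (E n) \<le> (\<Sum>p\<in>walks near_cells n v. prob {\<omega> \<in> space M. set p \<subseteq> occupied s \<omega>})"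
      unfolding E_eq using walks(1) occ(1) by (intro finite_measure_subadditive_finite) auto
    also have "\<dots> = (\<Sum>p\<in>walks near_cells n v. q ^ Suc n)"
    proof (rule sum.cong[OF refl])
      fix p assume "p \<in> walks near_cells n v"
      then have "card (set p) = Suc n"
        by (simp add: walks_def distinct_card)
      then show "prob {\<omega> \<in> space M. set p \<subseteq> occupied s \<omega>} = q ^ Suc n"
        using occ(2)[of p] by (simp add: q_def m_def)
    qed
    also have "\<dots> = real (card (walks near_cells n v)) * q ^ Suc n"
      by simp
    \<comment> \<open>One factor \<open>q\<close>, at most 1, is dropped to match the exponent of
      the number of walks.\<close>
    also have "\<dots> \<le> real ((9 ^ CARD('n)) ^ n) * q ^ n"
      using walks(2)[of n v] q by (intro mult_mono) (auto simp: mult_left_le_one_le simp del: of_nat_power)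
    also have "\<dots> = (9 ^ CARD('n) * q) ^ n"
      by (simp add: power_mult_distrib)
    also have "\<dots> \<le> (1 / 2) ^ n"
    proof (rule power_mono)
      have "9 ^ CARD('n) * q \<le> 9 ^ CARD('n) * m" using q by (intro mult_left_mono) auto
      also have "\<dots> \<le> 1 / 2" using small by (simp add: m_def mult.commute)
      finally show "9 ^ CARD('n) * q \<le> 1 / 2" .
    qed (use q in simp)
    finally show ?thesis .
  qed
  have "prob (\<Inter>n. E n) \<le> (1 / 2) ^ n" for n
    using finite_measure_mono[of "\<Inter>n. E n" "E n", OF _ ev] bound[of n] by (rule order_trans) auto
  moreover have "(\<lambda>n. (1 / 2 :: real) ^ n) \<longlonglongrightarrow> 0"
    by (intro LIMSEQ_power_zero) simp
  ultimately have "prob (\<Inter>n. E n) \<le> 0"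
    by (intro LIMSEQ_le_const) auto
  then have "prob (\<Inter>n. E n) = 0"
    using measure_nonneg[of M "\<Inter>n. E n"] by linarith
  then show ?thesis
    using ev by (intro null_setsI) (auto simp: emeasure_eq_measure)
qed

section \<open>The two bounds\<close>

text \<open>Almost surely every occupied cell has a finite cluster. Open boxes around the cells of
  one such cluster and of all other occupied cells then separate the covered set, which confines a
  connected component to a bounded union.\<close>

lemma no_percolation:
  fixes P :: "((real, 'n::{finite,linorder}) vec \<times> (real, 'n) vec) set measure"
  assumes pp: "poisson_process P (stick_intensity lam rigid_orientation)" and "0 < lam" and "2 \<le> L"
    and small: "lam * L * 9 ^ CARD('n) \<le> 1 / 2"
  shows "measure (completion P) {\<omega> \<in> space P. percolates (covered L \<omega>)} = 0"
proof -
  define k :: 'n where "k = sorted_list_of_set UNIV ! 1"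
  have e2: "e2 = axis k 1" by (simp add: e2_def k_def)
  define s :: "(real, 'n) vec" where "s = (\<chi> i. if i = k then L else 1)"
  have s: "\<And>i. 0 < s $ i" using \<open>2 \<le> L\<close> by (simp add: s_def)
  have prod: "(\<Prod>i\<in>UNIV. s $ i) = L"
    by (simp add: s_def)
  define E where "E n v = {\<omega> \<in> space P. \<exists>p\<in>walks near_cells n v. set p \<subseteq> occupied s \<omega>}" for n v
  have E: "(\<Inter>n. E n v) \<in> null_sets P" for v
    unfolding E_def using small by (intro long_walk_probability[OF pp \<open>0 < lam\<close> s]) (simp add: prod)
  \<comment> \<open>Points with another orientation have intensity zero, because the orientation law
    is the point mass at \<open>e2\<close>.\<close>
  define B :: "((real, 'n) vec \<times> (real, 'n) vec) set" where "B = UNIV \<times> (sphere 0 1 - {e2})"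
  have B: "B \<in> sets (stick_intensity lam rigid_orientation)"
    "emeasure (stick_intensity lam rigid_orientation) B = ennreal 0"
    using stick_intensity_times[of UNIV "sphere 0 1 - {e2}" lam] by (simp_all add: B_def)
  define N0 where "N0 = {\<omega> \<in> space P. \<omega> \<inter> B \<noteq> {}}"
  have "N0 \<in> null_sets P"
  proof -
    interpret prob_space P using pp unfolding poisson_process_def by (elim conjE)
    have "prob {\<omega> \<in> space P. \<omega> \<inter> B = {}} = 1"
      using poisson_void_probability[OF pp B] by (simp add: num_points_eq_0_iff)
    moreover have "N0 = space P - {\<omega> \<in> space P. \<omega> \<inter> B = {}}"
      by (auto simp: N0_def)
    ultimately have "prob N0 = 0"
      using prob_compl[OF measurable_empty_event(1)[OF pp B(1)]] by simp
    then show ?thesis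
      using measurable_empty_event(2)[OF pp B(1)]
      by (intro null_setsI) (auto simp: emeasure_eq_measure N0_def)
  qed
  define N where "N = N0 \<union> (\<Union>v. \<Inter>n. E n v)"
  have "N \<in> null_sets P"
    unfolding N_def using \<open>N0 \<in> null_sets P\<close> E by (intro null_sets.Un null_sets_UN) auto
  moreover have "{\<omega> \<in> space P. percolates (covered L \<omega>)} \<subseteq> N"
  proof (rule subsetI, rule ccontr)
    fix \<omega> assume "\<omega> \<in> {\<omega> \<in> space P. percolates (covered L \<omega>)}" and "\<omega> \<notin> N"
    then have \<omega>: "\<omega> \<in> space P" "\<omega> \<inter> B = {}" and noE: "\<And>v. \<exists>n. \<omega> \<notin> E n v"
      by (auto simp: N_def N0_def)
    obtain K where K: "K \<in> components (covered L \<omega>)" "\<not> bounded K"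
      using \<open>\<omega> \<in> {\<omega> \<in> space P. percolates (covered L \<omega>)}\<close> by (auto simp: percolates_def)
    have "\<forall>\<omega>\<in>space P. \<omega> \<subseteq> space (stick_intensity lam rigid_orientation)"
      using pp unfolding poisson_process_def by (elim conjE)
    moreover have "space (stick_intensity lam rigid_orientation) = (UNIV \<times> sphere 0 1 :: ((real, 'n) vec \<times> (real, 'n) vec) set)"
      by (simp add: stick_intensity_def space_scale_measure space_pair_measure space_rigid_orientation)
    ultimately have "\<omega> \<subseteq> UNIV \<times> sphere 0 1"
      using \<omega>(1) by simp
    then have dir: "p = e2" if "(x, p) \<in> \<omega>" for x p
      using that \<omega>(2) by (auto simp: B_def)
    \<comment> \<open>The cell enlarged by two side lengths on each side. A stick reaches at most
      one side length from its centre (along \<open>e2\<close> because \<open>L / 2 + 1\<close> is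
      at most \<open>L\<close>), so it lies in the open box. Boxes that overlap have indices
      differing by less than 5, which gives the radius 4 of \<open>near_cells\<close>.\<close>
    define Q where "Q v = box (\<chi> i. s $ i * (of_int (v $ i) - 2)) (\<chi> i. s $ i * (of_int (v $ i) + 3))" for v
    define idx where "idx x = (\<chi> i. \<lfloor>x $ i / s $ i\<rfloor>)" for x :: "(real, 'n) vec"
    have Q: "y \<in> Q (idx x) \<and> idx x \<in> occupied s \<omega>" if xp: "(x, p) \<in> \<omega>" "y \<in> stick x p L" for x p y
    proof
      have xc: "x \<in> cell s (idx x)"
        using mem_cell_iff[OF s] by (simp add: idx_def)
      show "idx x \<in> occupied s \<omega>"
        using xc xp(1) dir[OF xp(1)] by (auto simp: occupied_def)
      obtain t where t: "\<bar>t\<bar> \<le> L / 2" "norm (y - (x + t *\<^sub>R e2)) \<le> 1"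
        using xp(2) dir[OF xp(1)] mem_stick_iff[of L y x p] \<open>2 \<le> L\<close> by auto
      have dist: "\<bar>y $ i - x $ i\<bar> \<le> s $ i" for i
      proof -
        have "\<bar>(y - (x + t *\<^sub>R e2)) $ i\<bar> \<le> 1"
          using component_le_norm_cart[of "y - (x + t *\<^sub>R e2)" i] t(2) by linarith
        then show ?thesis
          using t(1) \<open>2 \<le> L\<close> by (auto simp: e2 axis_def s_def split: if_splits)
      qed
      have lower: "s $ i * of_int (idx x $ i) \<le> x $ i"
        and upper: "x $ i < s $ i * (of_int (idx x $ i) + 1)" for i
        using xc by (auto simp: cell_def)
      have "s $ i * (of_int (idx x $ i) - 2) < y $ i \<and> y $ i < s $ i * (of_int (idx x $ i) + 3)" for i
        using s[of i] dist[of i] lower[of i] upper[of i]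
        unfolding right_diff_distrib distrib_left abs_le_iff by linarith
      then show "y \<in> Q (idx x)"
        by (simp add: Q_def mem_box_cart)
    qed
    have near: "w \<in> near_cells v" if "y \<in> Q v" "y \<in> Q w" for v w y
      unfolding near_cells_def
    proof (intro CollectI allI)
      fix i
      have "s $ i * (of_int (v $ i) - 2) < s $ i * (of_int (w $ i) + 3)"
        "s $ i * (of_int (w $ i) - 2) < s $ i * (of_int (v $ i) + 3)"
        using that by (auto simp: Q_def mem_box_cart intro: less_trans)
      then have "real_of_int (v $ i) - 2 < of_int (w $ i) + 3" "real_of_int (w $ i) - 2 < of_int (v $ i) + 3"
        using s[of i] by (simp_all only: mult_less_cancel_left_pos)
      then show "\<bar>w $ i - v $ i\<bar> \<le> 4" by linarith
    qed
    obtain y0 where y0: "y0 \<in> K"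
      using in_components_nonempty[OF K(1)] by blast
    have K_sub: "K \<subseteq> covered L \<omega>" by (rule in_components_subset[OF K(1)])
    have cov: "\<exists>v\<in>occupied s \<omega>. y \<in> Q v" if yK: "y \<in> K" for y
    proof -
      obtain x p where "(x, p) \<in> \<omega>" "y \<in> stick x p L"
        using yK K_sub unfolding covered_def by blast
      from Q[OF this] show ?thesis by blast
    qed
    obtain v0 where v0: "v0 \<in> occupied s \<omega>" "y0 \<in> Q v0"
      using cov[OF y0] by blast
    obtain n where "\<omega> \<notin> E n v0" using noE by blast
    then have no: "\<not> set p \<subseteq> occupied s \<omega>" if "p \<in> walks near_cells n v0" for p
      using that \<omega>(1) by (auto simp: E_def)
    define C where "C = {(u, w). w \<in> near_cells u \<and> w \<in> occupied s \<omega>}\<^sup>* `` {v0}"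
    have "finite C"
      unfolding C_def by (rule finite_cluster[OF card_near_cells(1) v0(1) no])
    have C_closed: "w \<in> C" if "v \<in> C" "w \<in> near_cells v" "w \<in> occupied s \<omega>" for v w
      using that unfolding C_def by (auto intro: rtrancl_into_rtrancl)
    define U1 where "U1 = (\<Union>v\<in>C. Q v)"
    \<comment> \<open>\<open>U1\<close> and \<open>U2\<close> are disjoint: overlapping boxes belong
      to near cells, and \<open>C\<close> is closed under passing to near occupied cells.\<close>
    define U2 where "U2 = (\<Union>v\<in>occupied s \<omega> - C. Q v)"
    have "open U1" "open U2"
      unfolding U1_def U2_def Q_def by (auto intro: open_box)
    moreover have "K \<subseteq> U1 \<union> U2"
      using cov by (auto simp: U1_def U2_def)
    moreover have "U1 \<inter> U2 \<inter> K = {}"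
    proof -
      have False if y: "y \<in> U1" "y \<in> U2" for y
      proof -
        obtain v w where vw: "v \<in> C" "y \<in> Q v" "w \<in> occupied s \<omega>" "w \<notin> C" "y \<in> Q w"
          using y unfolding U1_def U2_def by blast
        show False
          using C_closed[OF vw(1) near[OF vw(2,5)] vw(3)] vw(4) by contradiction
      qed
      then show ?thesis by blast
    qed
    moreover have "y0 \<in> U1 \<inter> K"
      using y0 v0 by (auto simp: U1_def C_def)
    ultimately have "U2 \<inter> K = {}"
      using connectedD[OF in_components_connected[OF K(1)], of U1 U2] by blast
    then have "K \<subseteq> U1" using \<open>K \<subseteq> U1 \<union> U2\<close> by blast
    moreover have "bounded U1"
      unfolding U1_def Q_def using \<open>finite C\<close> by (auto intro: bounded_box)
    ultimately show False
      using K(2) bounded_subset by blast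
  qed
  ultimately show ?thesis
    by (intro measure_completion_subset_null)
qed

lemma unbounded_cluster_percolates:
  assumes "\<And>r. \<exists>y. connected_component (covered L \<omega>) x y \<and> norm y > r"
  shows "percolates (covered L \<omega>)"
proof -
  let ?K = "connected_component_set (covered L \<omega>) x"
  obtain y where "connected_component (covered L \<omega>) x y" using assms by blast
  then have "x \<in> covered L \<omega>" using connected_component_in by blast
  then have "?K \<in> components (covered L \<omega>)" by (simp add: components_def)
  moreover have "\<not> bounded ?K"
  proof
    assume "bounded ?K"
    then obtain r where "\<forall>y\<in>?K. norm y \<le> r" by (auto simp: bounded_iff)
    then show False using assms[of r] by force
  qed
  ultimately show ?thesis by (auto simp: percolates_def)
qed

text \<open>The value of \<open>lam * L\<close> makes the mean number of points per cell equal to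
  162, which gives a vacancy probability small enough for the renormalisation.\<close>

lemma percolation:
  fixes P :: "((real, 'n::{finite,linorder}) vec \<times> (real, 'n) vec) set measure"
  assumes pp: "poisson_process P (stick_intensity lam rigid_orientation)" and "0 < lam" and "0 < L"
    and d2: "CARD('n) \<ge> 2" and lam: "lam * L = 648 * real CARD('n) ^ (CARD('n) - 1)"
  shows "measure (completion P) {\<omega> \<in> space P. percolates (covered L \<omega>)} = 1"
proof -
  have "prob_space P" using pp unfolding poisson_process_def by (elim conjE)
  interpret prob_space P by fact
  define k :: 'n where "k = sorted_list_of_set UNIV ! 1"
  have e2: "e2 = axis k 1" by (simp add: e2_def k_def)
  have "\<exists>l. l \<noteq> k"
  proof (rule ccontr)
    assume "\<nexists>l. l \<noteq> k"
    then have "(UNIV :: 'n set) = {k}" by auto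
    then have "CARD('n) = card {k}" by (rule arg_cong)
    then show False using d2 by simp
  qed
  then obtain l where l: "l \<noteq> k" by blast
  define d where "d = real CARD('n)"
  have d: "d > 0" by (simp add: d_def)
  \<comment> \<open>Points in neighbouring cells are at most two side lengths apart in each
    coordinate: \<open>L / 2\<close> along \<open>e2\<close>, and \<open>2 / d\<close> in the
    others, which sum to at most the distance 2 allowed by
    \<open>parallel_sticks_meet\<close>.\<close>
  define s :: "(real, 'n) vec" where "s = (\<chi> i. if i = k then L / 4 else 1 / d)"
  have s: "\<And>i. 0 < s $ i" using \<open>0 < L\<close> d by (simp add: s_def)
  have prod: "(\<Prod>i\<in>UNIV. s $ i) = L / 4 * (1 / d) ^ (CARD('n) - 1)"
  proof -
    have "(\<Prod>i\<in>UNIV. s $ i) = s $ k * (\<Prod>i\<in>UNIV - {k}. s $ i)"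
      by (rule prod.remove) auto
    also have "(\<Prod>i\<in>UNIV - {k}. s $ i) = (\<Prod>i\<in>UNIV - {k}. 1 / d)"
      by (rule prod.cong) (auto simp: s_def)
    finally show ?thesis by (simp add: s_def card_Diff_singleton)
  qed
  have m: "lam * (\<Prod>i\<in>UNIV. s $ i) = 162"
  proof -
    have "lam * (\<Prod>i\<in>UNIV. s $ i) = lam * L / 4 * (1 / d) ^ (CARD('n) - 1)"
      by (simp add: prod)
    also have "\<dots> = 162"
      using d by (simp add: lam d_def power_one_over)
    finally show ?thesis .
  qed
  \<comment> \<open>The quadrant is placed in the plane spanned by directions \<open>l\<close> and
    \<open>k\<close>, with the first grid coordinate transverse to the sticks.\<close>
  define emb :: "nat \<times> nat \<Rightarrow> (int, 'n) vec" where
    "emb = (\<lambda>(i, j). \<chi> n. if n = l then int i else if n = k then int j else 0)"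
  have emb: "emb (i, j) $ l = int i" "emb (i, j) $ k = int j" for i j
    using l by (auto simp: emb_def)
  have inj: "inj emb"
  proof (rule injI)
    fix u v assume "emb u = emb v"
    then show "u = v"
      using emb[of "fst u" "snd u"] emb[of "fst v" "snd v"] by (simp add: prod_eq_iff)
  qed
  have close: "\<bar>emb (i, j) $ n - emb (i', j') $ n\<bar> \<le> 1"
    if "\<bar>int i - int i'\<bar> \<le> 1" "\<bar>int j - int j'\<bar> \<le> 1" for i j i' j' n
    using that by (simp add: emb_def)
  define E where "E n = {\<omega> \<in> space P. \<exists>S\<in>bad_witnesses n (0, 0). emb ` S \<inter> occupied s \<omega> = {}}" for n
  have E_eq: "E n = (\<Union>S\<in>bad_witnesses n (0, 0). {\<omega> \<in> space P. emb ` S \<inter> occupied s \<omega> = {}})" for n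
    by (auto simp: E_def)
  have fin: "finite (bad_witnesses n (0, 0))" for n
    by (simp add: card_bad_witnesses)
  note vac = vacant_cells_probability[OF pp \<open>0 < lam\<close> s]
  have evS: "{\<omega> \<in> space P. emb ` S \<inter> occupied s \<omega> = {}} \<in> events" if "S \<in> bad_witnesses n (0, 0)" for n S
    using card_bad_witness[OF that] by (intro vac(1)) simp
  have ev: "E n \<in> events" for n
    unfolding E_eq using fin evS by (intro sets.finite_UN) auto
  have bound: "prob (E n) \<le> (1 / 2) ^ n" for n
  proof -
    define q :: real where "q = exp (- 162)"
    \<comment> \<open>With this bound \<open>81 * q\<close> is at most one half, where 81 is the
      growth constant of the number of witnesses.\<close>
    have "q \<le> 1 / 162"
    proof -
      have "(162::real) \<le> exp 162" using exp_ge_add_one_self[of "162::real"] by simp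
      then show ?thesis by (simp add: q_def exp_minus field_simps)
    qed
    have "prob (E n) \<le> (\<Sum>S\<in>bad_witnesses n (0, 0). prob {\<omega> \<in> space P. emb ` S \<inter> occupied s \<omega> = {}})"
      unfolding E_eq using fin evS by (intro finite_measure_subadditive_finite) auto
    also have "\<dots> = (\<Sum>S\<in>bad_witnesses n (0, 0). q ^ 2 ^ n)"
    proof (rule sum.cong[OF refl])
      fix S assume "S \<in> bad_witnesses n (0, 0)"
      then have S: "finite S" "card S = 2 ^ n" by (simp_all add: card_bad_witness)
      have "card (emb ` S) = 2 ^ n"
        using S(2) card_image[OF inj_on_subset[OF inj subset_UNIV], of S] by simp
      then show "prob {\<omega> \<in> space P. emb ` S \<inter> occupied s \<omega> = {}} = q ^ 2 ^ n"
        using vac(2)[of "emb ` S"] S m by (simp add: q_def)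
    qed
    also have "\<dots> = real (card (bad_witnesses n (0, 0))) * q ^ 2 ^ n"
      by simp
    also have "\<dots> \<le> real (81 ^ 2 ^ n) * q ^ 2 ^ n"
    proof (rule mult_right_mono)
      have "card (bad_witnesses n (0, 0)) \<le> 81 ^ 2 ^ n"
        using card_bad_witnesses[of n "(0, 0)"] by linarith
      then show "real (card (bad_witnesses n (0, 0))) \<le> real (81 ^ 2 ^ n)"
        by (simp only: of_nat_le_iff)
    qed (simp add: q_def)
    also have "\<dots> = (81 * q) ^ 2 ^ n"
      by (simp add: power_mult_distrib)
    also have "\<dots> \<le> (1 / 2) ^ 2 ^ n"
      using \<open>q \<le> 1 / 162\<close> by (intro power_mono) (auto simp: q_def)
    also have "\<dots> \<le> (1 / 2) ^ n"
      by (intro power_decreasing) (auto intro: less_imp_le less_exp)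
    finally show ?thesis .
  qed
  have "AE \<omega> in P. eventually (\<lambda>n. \<omega> \<in> space P - E n) sequentially"
  proof (rule borel_cantelli_AE1)
    show "summable (\<lambda>n. prob (E n))"
    proof (rule summable_comparison_test'[where N = 0])
      show "summable (\<lambda>n. (1 / 2 :: real) ^ n)" by (rule summable_geometric) simp
      show "norm (prob (E n)) \<le> (1 / 2) ^ n" for n
        unfolding real_norm_def abs_of_nonneg[OF measure_nonneg] by (rule bound)
    qed
    show "E n \<in> events" for n by (rule ev)
    show "emeasure P (E n) < \<infinity>" for n
      by (simp add: emeasure_eq_measure)
  qed
  then have "AE \<omega> in P. percolates (covered L \<omega>)"
  proof (rule AE_mp, intro AE_I2 impI)
    fix \<omega> assume "\<omega> \<in> space P" and "eventually (\<lambda>n. \<omega> \<in> space P - E n) sequentially"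
    then obtain n0 where "\<forall>n\<ge>n0. \<omega> \<in> space P - E n"
      unfolding eventually_sequentially by blast
    then have n0: "\<omega> \<notin> E n" if "n \<ge> n0" for n
      using that by blast
    define occ where "occ i j \<longleftrightarrow> emb (i, j) \<in> occupied s \<omega>" for i j
    \<comment> \<open>One stick centre is selected in each occupied cell; connection of these
      centres is the relation \<open>R\<close>.\<close>
    define f where "f v = (SOME x. x \<in> cell s (emb v) \<and> (x, e2) \<in> \<omega>)" for v
    have f: "f (i, j) \<in> cell s (emb (i, j)) \<and> (f (i, j), e2) \<in> \<omega>" if "occ i j" for i j
      unfolding f_def
    proof (rule someI_ex)
      show "\<exists>x. x \<in> cell s (emb (i, j)) \<and> (x, e2) \<in> \<omega>"
        using that unfolding occ_def occupied_def by blast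
    qed
    define R where "R u v = connected_component (covered L \<omega>) (f u) (f v)" for u v
    have stick_sub: "stick (f (i, j)) e2 L \<subseteq> covered L \<omega>" if "occ i j" for i j
      using f[OF that] by (auto simp: covered_def)
    have link: "R (i, j) (i', j')"
      if "occ i j" "occ i' j'" "\<bar>int i - int i'\<bar> \<le> 1" "\<bar>int j - int j'\<bar> \<le> 1" for i j i' j'
    proof -
      define x where "x = f (i, j)"
      define x' where "x' = f (i', j')"
      have cl: "\<bar>x' $ n - x $ n\<bar> \<le> 2 * s $ n" for n
        using close_cells[OF s, of x "emb (i, j)" x' "emb (i', j')" n] f[OF that(1)] f[OF that(2)]
          close[OF that(3,4), of n] by (simp add: x_def x'_def)
      \<comment> \<open>Removing the difference along \<open>e2\<close> leaves a purely transverse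
        vector.\<close>
      define r where "r = x' $ k - x $ k"
      have "\<bar>r\<bar> \<le> L"
        using cl[of k] \<open>0 < L\<close> by (simp add: r_def s_def)
      moreover have "norm (x' - x - r *\<^sub>R e2) \<le> 2"
      proof -
        have "norm (x' - x - r *\<^sub>R e2) \<le> (\<Sum>n\<in>UNIV. \<bar>(x' - x - r *\<^sub>R e2) $ n\<bar>)"
          by (rule norm_le_l1_cart)
        also have "\<dots> \<le> (\<Sum>n\<in>(UNIV :: 'n set). 2 / d)"
        proof (rule sum_mono)
          fix n
          show "\<bar>(x' - x - r *\<^sub>R e2) $ n\<bar> \<le> 2 / d"
            using cl[of n] d by (auto simp: e2 axis_def r_def s_def)
        qed
        also have "\<dots> = 2" using d by (simp add: d_def)
        finally show ?thesis .
      qed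
      ultimately have meet: "stick x e2 L \<inter> stick x' e2 L \<noteq> {}"
        using \<open>0 < L\<close> by (intro parallel_sticks_meet) auto
      show ?thesis
        unfolding R_def connected_component_def
      proof (intro exI conjI)
        show "connected (stick x e2 L \<union> stick x' e2 L)"
          using meet \<open>0 < L\<close> by (intro connected_Un connected_stick) auto
        show "stick x e2 L \<union> stick x' e2 L \<subseteq> covered L \<omega>"
          using stick_sub that by (auto simp: x_def x'_def)
        show "f (i, j) \<in> stick x e2 L \<union> stick x' e2 L" "f (i', j') \<in> stick x e2 L \<union> stick x' e2 L"
          using \<open>0 < L\<close> by (auto simp: x_def x'_def intro: center_in_stick)
      qed
    qed
    interpret grid_links occ R
    proof
      show "R v u" if "R u v" for u v
        using that unfolding R_def by (rule connected_component_sym)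
      show "R u w" if "R u v" "R v w" for u v w
        using that unfolding R_def by (rule connected_component_trans)
    qed (simp_all add: link)
    have "good n 0 0" if "n \<ge> n0" for n
    proof (rule ccontr)
      assume "\<not> good n 0 0"
      then obtain S where S: "S \<in> bad_witnesses n (0, 0)" "\<forall>(a, b)\<in>S. \<not> occ a b"
        using bad_block_witness[of occ n 0 0] by blast
      then have "emb ` S \<inter> occupied s \<omega> = {}"
        by (auto simp: occ_def)
      then show False
        using n0[OF that] S(1) \<open>\<omega> \<in> space P\<close> by (auto simp: E_def)
    qed
    from infinite_cluster[OF this]
    obtain v where v: "\<forall>m. \<exists>i j. occ i j \<and> R v (i, j) \<and> i \<ge> m"
      by blast
    show "percolates (covered L \<omega>)"
    proof (rule unbounded_cluster_percolates)
      fix r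
      \<comment> \<open>Cells have width \<open>1 / d\<close> in direction \<open>l\<close>, so
        index \<open>m\<close> there means distance at least \<open>m / d\<close> from the
        origin.\<close>
      obtain m where m: "d * r < real m" using reals_Archimedean2 by blast
      obtain i j where ij: "occ i j" "R v (i, j)" "i \<ge> m" using v by blast
      have "r < 1 / d * real m" using m d by (simp add: field_simps)
      also have "\<dots> \<le> 1 / d * real i" using ij(3) d by (simp add: divide_right_mono)
      also have "\<dots> = s $ l * of_int (emb (i, j) $ l)" using l by (simp add: s_def emb)
      also have "\<dots> \<le> f (i, j) $ l" using f[OF ij(1)] by (auto simp: cell_def)
      also have "\<dots> \<le> norm (f (i, j))" using component_le_norm_cart[of "f (i, j)" l] by linarith
      finally show "\<exists>y. connected_component (covered L \<omega>) (f v) y \<and> norm y > r"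
        using ij(2) unfolding R_def by (intro exI[of _ "f (i, j)"]) simp
    qed
  qed
  then show ?thesis
    by (rule measure_completion_AE[OF \<open>prob_space P\<close>])
qed

theorem theorem1p2:
  assumes "CARD('n::{finite,linorder}) \<ge> 2"
  shows "\<exists>c C :: real. 0 < c \<and> c < C \<and>
    (\<exists>L\<^sub>0. \<forall>L\<ge>L\<^sub>0. \<forall>P :: real \<Rightarrow> ((real, 'n) vec \<times> (real, 'n) vec) set measure.
      (\<forall>lam>0. poisson_process (P lam) (stick_intensity lam rigid_orientation)) \<longrightarrow>
      ereal (c / L) \<le> critical_intensity P L \<and> critical_intensity P L \<le> ereal (C / L))"
proof -
  \<comment> \<open>Both constants are thresholds of the two preceding lemmas:
    \<open>lam * L\<close> below \<open>c\<close> excludes percolation, while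
    \<open>lam * L = C\<close> forces it.\<close>
  define c :: real where "c = 1 / (2 * 9 ^ CARD('n))"
  define C where "C = 648 * real CARD('n) ^ (CARD('n) - 1)"
  have "c * (2 * 9 ^ CARD('n)) = 1" and c: "0 < c" by (simp_all add: c_def)
  moreover have "c * 1 \<le> c * (2 * 9 ^ CARD('n))"
    using c one_le_power[of "9::real" "CARD('n)"] by (intro mult_left_mono) linarith+
  ultimately have "c \<le> 1" by linarith
  have C: "1 < C"
  proof -
    have "1 \<le> real CARD('n) ^ (CARD('n) - 1)"
      using assms by (intro one_le_power) simp
    then show ?thesis unfolding C_def by linarith
  qed
  have "ereal (c / L) \<le> critical_intensity P L \<and> critical_intensity P L \<le> ereal (C / L)"
    if L: "2 \<le> L" and P: "\<forall>lam>0. poisson_process (P lam) (stick_intensity lam rigid_orientation)"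
    for L and P :: "real \<Rightarrow> ((real, 'n) vec \<times> (real, 'n) vec) set measure"
  proof
    show "ereal (c / L) \<le> critical_intensity P L"
      unfolding critical_intensity_def
    proof (rule Inf_greatest)
      fix x assume "x \<in> {ereal lam |lam. 0 < lam \<and>
        measure (completion (P lam)) {\<omega> \<in> space (P lam). percolates (covered L \<omega>)} = 1}"
      then obtain lam where lam: "x = ereal lam" "0 < lam"
        "measure (completion (P lam)) {\<omega> \<in> space (P lam). percolates (covered L \<omega>)} = 1"
        by blast
      have "c / L \<le> lam"
      proof (rule ccontr)
        assume "\<not> c / L \<le> lam"
        then have "lam * L * 9 ^ CARD('n) \<le> 1 / 2"
          using L by (simp add: c_def field_simps)
        then show False
          using no_percolation[OF P[rule_format, OF lam(2)] lam(2) L] lam(3) by simp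
      qed
      then show "ereal (c / L) \<le> x" by (simp add: lam(1))
    qed
    have "0 < C / L" using C L by simp
    moreover have "C / L * L = 648 * real CARD('n) ^ (CARD('n) - 1)"
      using L by (simp add: C_def)
    ultimately show "critical_intensity P L \<le> ereal (C / L)"
      unfolding critical_intensity_def using percolation[OF P[rule_format] _ _ assms, of "C / L" L] L
      by (intro Inf_lower) auto
  qed
  \<comment> \<open>The threshold length 2 is the one in \<open>no_percolation\<close>.\<close>
  then show ?thesis
    using c \<open>c \<le> 1\<close> C by (intro exI[of _ c] exI[of _ C] conjI exI[of _ 2]) auto
qed

end
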